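(* Let $R$ be a ring with unity, let $\mathcal{X}$ be a semibrick of left $R$-modules and let $M\in\mathrm{Filt}(\mathcal{X})$. The following statements are equivalent: (i) $M$ is $\mathcal{X}$-semisimple; (ii) $\mathrm{tr}_{\mathcal{X}}\,M=M$.
   Context: A brick is a finitely presented left $R$-module whose endomorphism ring is a division ring. A semibrick is a class $\mathcal{X}$ of pairwise non-isomorphic bricks with $\mathrm{Hom}(X,X')=0$ for distinct $X,X'\in\mathcal{X}$. A filtration of a module $M$ is an ascending chain $(M_\lambda,\lambda\le\mu)$ of submodules ($\mu$ an ordinal) with $M_0=0$, $M_\mu=M$ and $M_\nu=\bigcup_{\lambda<\nu}M_\lambda$ for limit ordinals $\nu\le\mu$. It is an $\mathcal{X}$-filtration if each $M_{\lambda+1}/M_\lambda$ ($\lambda<\mu$) is isomorphic to a module in $\mathcal{X}$. $\mathrm{Filt}(\mathcal{X})$ is the class of modules admitting an $\mathcal{X}$-filtration. The $\mathcal{X}$-trace of $M$ is $\mathrm{tr}_{\mathcal{X}}M=\sum_{X\in\mathcal{X},\,f\in\mathrm{Hom}(X,M)}\mathrm{Im}\,f$. A module $M\in\mathrm{Filt}(\mathcal{X})$ is $\mathcal{X}$-semisimple if it is isomorphic to a direct sum of objects from $\mathcal{X}$ (repetitions allowed). *)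

theory Defs
  imports "HOL-Algebra.Module" "HOL-Algebra.AbelCoset"
begin

text \<open>
  The locale \<open>module\<close> of the library is restricted to commutative rings. Left modules over an
  arbitrary unital ring reuse its record type; the fields \<open>mult\<close> and \<open>one\<close> of that record
  carry no meaning for a module.
\<close>

locale left_module = R?: ring R + M?: abelian_group M
  for R :: "('r, 's) ring_scheme" (structure) and M :: "('r, 'm) module" (structure) +
  assumes smult_closed [simp, intro]:
      "\<lbrakk>a \<in> carrier R; x \<in> carrier M\<rbrakk> \<Longrightarrow> a \<odot>\<^bsub>M\<^esub> x \<in> carrier M"
    and smult_l_distr:
      "\<lbrakk>a \<in> carrier R; b \<in> carrier R; x \<in> carrier M\<rbrakk> \<Longrightarrow>
        (a \<oplus>\<^bsub>R\<^esub> b) \<odot>\<^bsub>M\<^esub> x = (a \<odot>\<^bsub>M\<^esub> x) \<oplus>\<^bsub>M\<^esub> (b \<odot>\<^bsub>M\<^esub> x)"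
    and smult_r_distr:
      "\<lbrakk>a \<in> carrier R; x \<in> carrier M; y \<in> carrier M\<rbrakk> \<Longrightarrow>
        a \<odot>\<^bsub>M\<^esub> (x \<oplus>\<^bsub>M\<^esub> y) = (a \<odot>\<^bsub>M\<^esub> x) \<oplus>\<^bsub>M\<^esub> (a \<odot>\<^bsub>M\<^esub> y)"
    and smult_assoc:
      "\<lbrakk>a \<in> carrier R; b \<in> carrier R; x \<in> carrier M\<rbrakk> \<Longrightarrow>
        (a \<otimes>\<^bsub>R\<^esub> b) \<odot>\<^bsub>M\<^esub> x = a \<odot>\<^bsub>M\<^esub> (b \<odot>\<^bsub>M\<^esub> x)"
    and smult_one [simp]:
      "x \<in> carrier M \<Longrightarrow> \<one>\<^bsub>R\<^esub> \<odot>\<^bsub>M\<^esub> x = x"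

definition lm_hom ::
    "('r, 's) ring_scheme \<Rightarrow> ('r, 'm) module \<Rightarrow> ('r, 'n) module \<Rightarrow> ('m \<Rightarrow> 'n) set" where
  "lm_hom R M N =
    {f \<in> carrier M \<rightarrow> carrier N.
      (\<forall>x\<in>carrier M. \<forall>y\<in>carrier M. f (x \<oplus>\<^bsub>M\<^esub> y) = f x \<oplus>\<^bsub>N\<^esub> f y) \<and>
      (\<forall>a\<in>carrier R. \<forall>x\<in>carrier M. f (a \<odot>\<^bsub>M\<^esub> x) = a \<odot>\<^bsub>N\<^esub> f x)}"

definition lm_isomorphic ::
    "('r, 's) ring_scheme \<Rightarrow> ('r, 'm) module \<Rightarrow> ('r, 'n) module \<Rightarrow> bool" where
  "lm_isomorphic R M N \<longleftrightarrow> (\<exists>f\<in>lm_hom R M N. bij_betw f (carrier M) (carrier N))"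

definition hom_zero ::
    "('r, 's) ring_scheme \<Rightarrow> ('r, 'm) module \<Rightarrow> ('r, 'n) module \<Rightarrow> bool" where
  "hom_zero R M N \<longleftrightarrow> (\<forall>f\<in>lm_hom R M N. \<forall>x\<in>carrier M. f x = \<zero>\<^bsub>N\<^esub>)"

definition direct_sum :: "'i set \<Rightarrow> ('i \<Rightarrow> ('r, 'x) module) \<Rightarrow> ('r, 'i \<Rightarrow> 'x) module" where
  "direct_sum I F =
    \<lparr>carrier = {u \<in> \<Pi>\<^sub>E i\<in>I. carrier (F i). finite {i \<in> I. u i \<noteq> \<zero>\<^bsub>F i\<^esub>}},
     mult = undefined, one = undefined,
     zero = (\<lambda>i\<in>I. \<zero>\<^bsub>F i\<^esub>),
     add = (\<lambda>u v. \<lambda>i\<in>I. u i \<oplus>\<^bsub>F i\<^esub> v i),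
     smult = (\<lambda>a u. \<lambda>i\<in>I. a \<odot>\<^bsub>F i\<^esub> u i)\<rparr>"

definition regular_module :: "('r, 's) ring_scheme \<Rightarrow> ('r, 'r) module" where
  "regular_module R =
    \<lparr>carrier = carrier R, mult = undefined, one = undefined,
     zero = \<zero>\<^bsub>R\<^esub>, add = add R, smult = mult R\<rparr>"

definition free_module :: "('r, 's) ring_scheme \<Rightarrow> nat \<Rightarrow> ('r, nat \<Rightarrow> 'r) module" where
  "free_module R n = direct_sum {..<n} (\<lambda>_. regular_module R)"

text \<open>Existence of an exact sequence of left modules \<open>R\<^sup>m \<rightarrow> R\<^sup>n \<rightarrow> M \<rightarrow> 0\<close>.\<close>

definition finitely_presented :: "('r, 's) ring_scheme \<Rightarrow> ('r, 'm) module \<Rightarrow> bool" where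
  "finitely_presented R M \<longleftrightarrow>
    (\<exists>m n. \<exists>f\<in>lm_hom R (free_module R m) (free_module R n). \<exists>g\<in>lm_hom R (free_module R n) M.
      f ` carrier (free_module R m) = {u \<in> carrier (free_module R n). g u = \<zero>\<^bsub>M\<^esub>} \<and>
      g ` carrier (free_module R n) = carrier M)"

text \<open>
  Endomorphisms are restricted to the carrier, so that equality of elements of the ring is
  equality of endomorphisms.
\<close>

definition End_ring :: "('r, 's) ring_scheme \<Rightarrow> ('r, 'm) module \<Rightarrow> ('m \<Rightarrow> 'm) ring" where
  "End_ring R M =
    \<lparr>carrier = lm_hom R M M \<inter> extensional (carrier M),
     mult = compose (carrier M),
     one = (\<lambda>x\<in>carrier M. x),
     zero = (\<lambda>x\<in>carrier M. \<zero>\<^bsub>M\<^esub>),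
     add = (\<lambda>f g. \<lambda>x\<in>carrier M. f x \<oplus>\<^bsub>M\<^esub> g x)\<rparr>"

locale div_ring = ring +
  assumes one_not_zero: "\<one> \<noteq> \<zero>"
    and div_Units: "Units R = carrier R - {\<zero>}"

definition brick :: "('r, 's) ring_scheme \<Rightarrow> ('r, 'm) module \<Rightarrow> bool" where
  "brick R X \<longleftrightarrow> left_module R X \<and> finitely_presented R X \<and> div_ring (End_ring R X)"

definition semibrick :: "('r, 's) ring_scheme \<Rightarrow> ('r, 'm) module set \<Rightarrow> bool" where
  "semibrick R \<X> \<longleftrightarrow>
    (\<forall>X\<in>\<X>. brick R X) \<and>
    (\<forall>X\<in>\<X>. \<forall>X'\<in>\<X>. X \<noteq> X' \<longrightarrow> \<not> lm_isomorphic R X X' \<and> hom_zero R X X')"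

text \<open>The quotient \<open>N/H\<close> of submodules \<open>H \<subseteq> N\<close> of \<open>M\<close>.\<close>

definition quot_module :: "('r, 'm) module \<Rightarrow> 'm set \<Rightarrow> 'm set \<Rightarrow> ('r, 'm set) module" where
  "quot_module M N H =
    \<lparr>carrier = a_rcosets\<^bsub>M\<lparr>carrier := N\<rparr>\<^esub> H, mult = undefined, one = undefined,
     zero = H, add = set_add M,
     smult = (\<lambda>a A. \<Union>x\<in>A. H +>\<^bsub>M\<^esub> (a \<odot>\<^bsub>M\<^esub> x))\<rparr>"

text \<open>
  An ordinal \<open>\<mu>\<close> is given by a well-order \<open>r\<close> with greatest element \<open>\<mu>\<close>, whose field plays the
  role of \<open>{\<lambda>. \<lambda> \<le> \<mu>}\<close>.
\<close>

definition is_succ :: "'i rel \<Rightarrow> 'i \<Rightarrow> 'i \<Rightarrow> bool" where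
  "is_succ r i j \<longleftrightarrow> (i, j) \<in> r \<and> i \<noteq> j \<and> (\<forall>k. (i, k) \<in> r \<and> i \<noteq> k \<longrightarrow> (j, k) \<in> r)"

definition is_limit :: "'i rel \<Rightarrow> 'i \<Rightarrow> bool" where
  "is_limit r i \<longleftrightarrow> i \<in> Field r \<and> underS r i \<noteq> {} \<and> (\<nexists>j. is_succ r j i)"

definition filtration ::
    "('r, 's) ring_scheme \<Rightarrow> ('r, 'm) module \<Rightarrow> 'i rel \<Rightarrow> 'i \<Rightarrow> ('i \<Rightarrow> 'm set) \<Rightarrow> bool" where
  "filtration R M r \<mu> C \<longleftrightarrow>
    Well_order r \<and> \<mu> \<in> Field r \<and> (\<forall>i\<in>Field r. (i, \<mu>) \<in> r) \<and>
    (\<forall>i\<in>Field r. submodule (C i) R M) \<and>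
    (\<forall>i j. (i, j) \<in> r \<longrightarrow> C i \<subseteq> C j) \<and>
    (\<forall>i\<in>Field r. underS r i = {} \<longrightarrow> C i = {\<zero>\<^bsub>M\<^esub>}) \<and>
    C \<mu> = carrier M \<and>
    (\<forall>i. is_limit r i \<longrightarrow> C i = (\<Union>j\<in>underS r i. C j))"

definition X_filtration ::
    "('r, 's) ring_scheme \<Rightarrow> ('r, 'x) module set \<Rightarrow> ('r, 'm) module \<Rightarrow>
      'i rel \<Rightarrow> 'i \<Rightarrow> ('i \<Rightarrow> 'm set) \<Rightarrow> bool" where
  "X_filtration R \<X> M r \<mu> C \<longleftrightarrow>
    filtration R M r \<mu> C \<and>
    (\<forall>i j. is_succ r i j \<longrightarrow> (\<exists>X\<in>\<X>. lm_isomorphic R (quot_module M (C j) (C i)) X))"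

text \<open>
  The ordinals are represented by well-orders on the type of the elements of \<open>M\<close>. For nonzero
  factors this type is always large enough, see \<open>FiltI\<close> below.
\<close>

definition Filt :: "('r, 's) ring_scheme \<Rightarrow> ('r, 'x) module set \<Rightarrow> ('r, 'm) module set" where
  "Filt R \<X> =
    {M. left_module R M \<and> (\<exists>(r :: 'm rel) \<mu> C. X_filtration R \<X> M r \<mu> C)}"

definition sum_submodules ::
    "('r, 's) ring_scheme \<Rightarrow> ('r, 'm) module \<Rightarrow> 'm set set \<Rightarrow> 'm set" where
  "sum_submodules R M \<N> = \<Inter>{H. submodule H R M \<and> \<Union>\<N> \<subseteq> H}"

definition X_trace ::
    "('r, 's) ring_scheme \<Rightarrow> ('r, 'x) module set \<Rightarrow> ('r, 'm) module \<Rightarrow> 'm set" where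
  "X_trace R \<X> M = sum_submodules R M {f ` carrier X |X f. X \<in> \<X> \<and> f \<in> lm_hom R X M}"

text \<open>
  Likewise, the type of the elements of \<open>M\<close> is a large enough supply of indices for a direct sum
  of nonzero modules, see \<open>X_semisimpleI\<close> below.
\<close>

definition X_semisimple ::
    "('r, 's) ring_scheme \<Rightarrow> ('r, 'x) module set \<Rightarrow> ('r, 'm) module \<Rightarrow> bool" where
  "X_semisimple R \<X> M \<longleftrightarrow>
    M \<in> Filt R \<X> \<and> (\<exists>(I :: 'm set) F. F \<in> I \<rightarrow> \<X> \<and> lm_isomorphic R M (direct_sum I F))"

lemma semibrick_nonzero:
  assumes "semibrick R \<X>" "X \<in> \<X>"
  shows "\<exists>x\<in>carrier X. x \<noteq> \<zero>\<^bsub>X\<^esub>"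
proof (rule ccontr)
  assume "\<not> ?thesis"
  then have "\<one>\<^bsub>End_ring R X\<^esub> = \<zero>\<^bsub>End_ring R X\<^esub>"
    by (auto simp: End_ring_def restrict_def fun_eq_iff)
  moreover have "div_ring (End_ring R X)"
    using assms by (auto simp: semibrick_def brick_def)
  ultimately show False
    using div_ring.one_not_zero by blast
qed

lemma is_succ_dir_image:
  assumes inj: "inj_on g (Field r)" and "is_succ (dir_image r g) a b"
  obtains i j where "a = g i" "b = g j" "is_succ r i j"
proof -
  obtain i j where ij: "a = g i" "b = g j" "(i, j) \<in> r"
    using assms(2) by (auto simp: is_succ_def dir_image_def)
  have "is_succ r i j"
    unfolding is_succ_def
  proof (intro conjI allI impI)
    show "(i, j) \<in> r" by fact
    show "i \<noteq> j" using assms(2) ij by (auto simp: is_succ_def)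
  next
    fix k assume k: "(i, k) \<in> r \<and> i \<noteq> k"
    then have "(g i, g k) \<in> dir_image r g" "g i \<noteq> g k"
      using inj by (auto simp: dir_image_def inj_on_def Field_def)
    then have "(g j, g k) \<in> dir_image r g"
      using assms(2) ij by (auto simp: is_succ_def)
    then obtain j' k' where "(j', k') \<in> r" "g j = g j'" "g k = g k'"
      by (auto simp: dir_image_def)
    moreover from this have "j = j'" "k = k'"
      using inj ij k by (auto simp: inj_on_def Field_def)
    ultimately show "(j, k) \<in> r" by simp
  qed
  with ij that show thesis by blast
qed

lemma is_succ_dir_imageI:
  assumes inj: "inj_on g (Field r)" and s: "is_succ r i j"
  shows "is_succ (dir_image r g) (g i) (g j)"
  unfolding is_succ_def
proof (intro conjI allI impI)
  show "(g i, g j) \<in> dir_image r g" using s by (auto simp: is_succ_def dir_image_def)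
  show "g i \<noteq> g j" using s inj by (auto simp: is_succ_def inj_on_def Field_def)
next
  fix c assume c: "(g i, c) \<in> dir_image r g \<and> g i \<noteq> c"
  then obtain i' k where k: "(i', k) \<in> r" "g i = g i'" "c = g k"
    by (auto simp: dir_image_def)
  then have "i' = i"
    using inj s by (auto simp: inj_on_def is_succ_def Field_def)
  with k c s show "(g j, c) \<in> dir_image r g"
    by (auto simp: is_succ_def dir_image_def)
qed

lemma underS_dir_image:
  assumes "inj_on g (Field r)" "i \<in> Field r"
  shows "underS (dir_image r g) (g i) = g ` underS r i"
proof
  show "underS (dir_image r g) (g i) \<subseteq> g ` underS r i"
  proof
    fix c assume "c \<in> underS (dir_image r g) (g i)"
    then obtain a b where ab: "(a, b) \<in> r" "c = g a" "g i = g b" "c \<noteq> g i"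
      by (auto simp: underS_def dir_image_def)
    then have "b = i" using assms by (auto simp: inj_on_def Field_def)
    with ab show "c \<in> g ` underS r i" by (auto simp: underS_def)
  qed
  show "g ` underS r i \<subseteq> underS (dir_image r g) (g i)"
    using assms by (auto simp: underS_def dir_image_def inj_on_def Field_def)
qed

lemma FiltI:
  fixes r :: "'i rel" and M :: "('r, 'm) module"
  assumes M: "left_module R M" and X: "semibrick R \<X>" and filt: "X_filtration R \<X> M r \<mu> C"
  shows "M \<in> Filt R \<X>"
proof -
  interpret left_module R M by fact
  have f: "filtration R M r \<mu> C" using filt by (simp add: X_filtration_def)
  have wo: "Well_order r" and mu: "\<mu> \<in> Field r" and top: "\<And>i. i \<in> Field r \<Longrightarrow> (i, \<mu>) \<in> r"
    and sub: "\<And>i. i \<in> Field r \<Longrightarrow> submodule (C i) R M"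
    and mono: "\<And>i j. (i, j) \<in> r \<Longrightarrow> C i \<subseteq> C j"
    and zero: "\<And>i. i \<in> Field r \<Longrightarrow> underS r i = {} \<Longrightarrow> C i = {\<zero>\<^bsub>M\<^esub>}"
    and C_top: "C \<mu> = carrier M"
    and lim: "\<And>i. is_limit r i \<Longrightarrow> C i = (\<Union>j\<in>underS r i. C j)"
    using f by (auto simp: filtration_def)
  interpret W: wo_rel r using wo by (simp add: wo_rel_def)
  have strict: "\<exists>x\<in>C j. x \<notin> C i" if s: "is_succ r i j" for i j
  proof (rule ccontr)
    assume contra: "\<not> ?thesis"
    have ij: "(i, j) \<in> r" "i \<in> Field r" "j \<in> Field r"
      using s by (auto simp: is_succ_def Field_def)
    have eq: "C j = C i" using contra mono[OF ij(1)] by auto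
    interpret Ci: submodule "C i" R M using sub ij by blast
    have coset: "C i +>\<^bsub>M\<^esub> x = C i" if "x \<in> C i" for x
      using subgroup.rcos_const[OF Ci.subgroup_axioms a_group that] by (simp add: a_r_coset_def)
    have "carrier (quot_module M (C j) (C i)) = (\<lambda>x. C i +>\<^bsub>M\<^esub> x) ` C i"
      by (auto simp: quot_module_def eq A_RCOSETS_def RCOSETS_def r_coset_def a_r_coset_def)
    then have single: "carrier (quot_module M (C j) (C i)) \<subseteq> {C i}"
      using coset by auto
    obtain X h where Xh: "X \<in> \<X>" "bij_betw h (carrier (quot_module M (C j) (C i))) (carrier X)"
      using filt s unfolding X_filtration_def lm_isomorphic_def by blast
    obtain x where x: "x \<in> carrier X" "x \<noteq> \<zero>\<^bsub>X\<^esub>"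
      using semibrick_nonzero[OF X Xh(1)] by blast
    have "left_module R X" using X Xh(1) by (auto simp: semibrick_def brick_def)
    then interpret LX: left_module R X .
    have "carrier X \<subseteq> {h (C i)}" using single bij_betw_imp_surj_on[OF Xh(2)] by auto
    moreover have "\<zero>\<^bsub>X\<^esub> \<in> carrier X" by simp
    ultimately show False using x by (metis singletonD subsetD)
  qed
  have ex_succ: "\<exists>j. is_succ r i j" if i: "i \<in> Field r" "i \<noteq> \<mu>" for i
  proof -
    have ne: "AboveS r {i} \<noteq> {}"
      using i top[OF i(1)] mu by (auto simp: AboveS_def)
    have sub: "{i} \<subseteq> Field r" using i by simp
    have "is_succ r i (W.suc {i})"
      unfolding is_succ_def
    proof (intro conjI allI impI)
      have "W.suc {i} \<in> AboveS r {i}" using W.suc_AboveS[OF sub ne] .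
      then show "(i, W.suc {i}) \<in> r" "i \<noteq> W.suc {i}" by (auto simp: AboveS_def)
    next
      fix k assume "(i, k) \<in> r \<and> i \<noteq> k"
      then have "k \<in> AboveS r {i}" by (auto simp: AboveS_def Field_def)
      then show "(W.suc {i}, k) \<in> r" using W.suc_least_AboveS by blast
    qed
    then show ?thesis ..
  qed
  define P where "P i x \<longleftrightarrow> x \<notin> C i \<and> (\<forall>k. (i, k) \<in> r \<and> i \<noteq> k \<longrightarrow> x \<in> C k)" for i x
  have exP: "\<exists>x. P i x" if i: "i \<in> Field r" "i \<noteq> \<mu>" for i
  proof -
    obtain j where j: "is_succ r i j" using ex_succ[OF i] by blast
    obtain x where x: "x \<in> C j" "x \<notin> C i" using strict[OF j] by blast
    then have "P i x" using j mono by (auto simp: P_def is_succ_def)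
    then show ?thesis ..
  qed
  define g where "g i = (if i = \<mu> then \<zero>\<^bsub>M\<^esub> else SOME x. P i x)" for i
  have g: "P i (g i)" if "i \<in> Field r" "i \<noteq> \<mu>" for i
    using someI_ex[OF exP[OF that]] that by (simp add: g_def)
  have z: "\<zero>\<^bsub>M\<^esub> \<in> C i" if "i \<in> Field r" for i
  proof -
    interpret submodule "C i" R M using sub that .
    show ?thesis using one_closed by simp
  qed
  have neq: "g i \<noteq> g j" if ij: "(i, j) \<in> r" "i \<noteq> j" for i j
  proof -
    have F: "i \<in> Field r" "j \<in> Field r" using ij by (auto simp: Field_def)
    have "i \<noteq> \<mu>" using ij top[OF F(2)] W.ANTISYM by (auto dest: antisymD)
    then have Pi: "P i (g i)" using g F by blast
    show ?thesis
    proof (cases "j = \<mu>")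
      case True
      then show ?thesis using Pi z[OF F(1)] by (auto simp: g_def[of \<mu>] P_def)
    next
      case False
      then show ?thesis using Pi g[OF F(2)] ij by (auto simp: P_def)
    qed
  qed
  have inj: "inj_on g (Field r)"
  proof (rule inj_onI, rule ccontr)
    fix i j assume "i \<in> Field r" "j \<in> Field r" "g i = g j" "i \<noteq> j"
    moreover from this have "(i, j) \<in> r \<or> (j, i) \<in> r" using W.TOTALS by auto
    ultimately show False using neq by metis
  qed
  define r' where "r' = dir_image r g"
  define C' where "C' = C \<circ> inv_into (Field r) g"
  have C': "C' (g i) = C i" if "i \<in> Field r" for i
    using that inj by (simp add: C'_def)
  have F': "Field r' = g ` Field r" by (simp add: r'_def dir_image_Field)
  have uS: "underS r' (g i) = g ` underS r i" if "i \<in> Field r" for i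
    using underS_dir_image[OF inj that] by (simp add: r'_def)
  have "X_filtration R \<X> M r' (g \<mu>) C'"
    unfolding X_filtration_def filtration_def
  proof (intro conjI allI ballI impI)
    show "Well_order r'" using Well_order_dir_image[OF wo inj] by (simp add: r'_def)
    show "g \<mu> \<in> Field r'" using mu F' by simp
    show "(a, g \<mu>) \<in> r'" if "a \<in> Field r'" for a
      using that top F' by (auto simp: r'_def dir_image_def)
    show "submodule (C' a) R M" if "a \<in> Field r'" for a
      using that sub F' C' by auto
    show "C' a \<subseteq> C' b" if ab: "(a, b) \<in> r'" for a b
    proof -
      obtain i j where ij: "a = g i" "b = g j" "(i, j) \<in> r"
        using ab by (auto simp: r'_def dir_image_def)
      then have "i \<in> Field r" "j \<in> Field r" by (auto simp: Field_def)
      then show ?thesis using mono[OF ij(3)] ij C' by simp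
    qed
    show "C' a = {\<zero>\<^bsub>M\<^esub>}" if "a \<in> Field r'" "underS r' a = {}" for a
      using that zero F' C' uS by auto
    show "C' (g \<mu>) = carrier M" using C' mu C_top by simp
    show "C' a = (\<Union>b\<in>underS r' a. C' b)" if l: "is_limit r' a" for a
    proof -
      obtain i where i: "i \<in> Field r" "a = g i" using l F' by (auto simp: is_limit_def)
      have "is_limit r i"
        using l i uS[OF i(1)] is_succ_dir_imageI[OF inj] unfolding is_limit_def r'_def
        by (metis image_is_empty)
      then have "C i = (\<Union>j\<in>underS r i. C j)" using lim by blast
      moreover have "C' (g j) = C j" if "j \<in> underS r i" for j
        using that C' by (auto simp: underS_def Field_def)
      ultimately show ?thesis using i C' uS by simp
    qed
    show "\<exists>X\<in>\<X>. lm_isomorphic R (quot_module M (C' b) (C' a)) X" if s: "is_succ r' a b" for a b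
    proof -
      obtain i j where ij: "a = g i" "b = g j" "is_succ r i j"
        using is_succ_dir_image[OF inj s[unfolded r'_def]] by metis
      then have "i \<in> Field r" "j \<in> Field r" by (auto simp: is_succ_def Field_def)
      then show ?thesis using filt ij C' by (simp add: X_filtration_def)
    qed
  qed
  with M show ?thesis by (auto simp: Filt_def)
qed

lemma X_semisimpleI:
  fixes I :: "'i set" and M :: "('r, 'm) module"
  assumes M: "M \<in> Filt R \<X>" and X: "semibrick R \<X>"
    and F: "F \<in> I \<rightarrow> \<X>" and iso: "lm_isomorphic R M (direct_sum I F)"
  shows "X_semisimple R \<X> M"
proof -
  obtain h where h: "h \<in> lm_hom R M (direct_sum I F)"
    "bij_betw h (carrier M) (carrier (direct_sum I F))"
    using iso by (auto simp: lm_isomorphic_def)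
  have Fm: "left_module R (F i)" if "i \<in> I" for i
    using F X that by (auto simp: semibrick_def brick_def)
  have Fz: "\<zero>\<^bsub>F i\<^esub> \<in> carrier (F i)" if "i \<in> I" for i
  proof -
    interpret left_module R "F i" using Fm that .
    show ?thesis by simp
  qed
  have "\<forall>i\<in>I. \<exists>x\<in>carrier (F i). x \<noteq> \<zero>\<^bsub>F i\<^esub>"
    using F semibrick_nonzero[OF X] by blast
  then obtain x where x: "\<And>i. i \<in> I \<Longrightarrow> x i \<in> carrier (F i) \<and> x i \<noteq> \<zero>\<^bsub>F i\<^esub>"
    by metis
  define d where "d i = (\<lambda>j\<in>I. if j = i then x i else \<zero>\<^bsub>F j\<^esub>)" for i
  have d: "d i \<in> carrier (direct_sum I F)" if "i \<in> I" for i
  proof -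
    have "{j \<in> I. d i j \<noteq> \<zero>\<^bsub>F j\<^esub>} \<subseteq> {i}" by (auto simp: d_def)
    then have "finite {j \<in> I. d i j \<noteq> \<zero>\<^bsub>F j\<^esub>}" using finite_subset by blast
    moreover have "d i \<in> (\<Pi>\<^sub>E j\<in>I. carrier (F j))"
      using x that Fz by (auto simp: d_def)
    ultimately show ?thesis by (simp add: direct_sum_def)
  qed
  have inj_d: "inj_on d I"
  proof (rule inj_onI, rule ccontr)
    fix i j assume ij: "i \<in> I" "j \<in> I" "d i = d j" "i \<noteq> j"
    then have "d i i = d j i" by simp
    then show False using ij x by (simp add: d_def)
  qed
  define g where "g i = inv_into (carrier M) h (d i)" for i
  have inj: "inj_on g I"
  proof (rule inj_onI)
    fix i j assume ij: "i \<in> I" "j \<in> I" "g i = g j"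
    have "h (g i) = d i" "h (g j) = d j"
      using bij_betw_inv_into_right[OF h(2) d[OF ij(1)]] bij_betw_inv_into_right[OF h(2) d[OF ij(2)]]
      by (simp_all only: g_def)
    then show "i = j" using ij inj_d by (auto simp: inj_on_def)
  qed
  define J where "J = g ` I"
  define k where "k = inv_into I g"
  have k: "k a \<in> I" "g (k a) = a" if "a \<in> J" for a
    using that by (auto simp: J_def k_def inv_into_into f_inv_into_f)
  have kg: "k (g i) = i" "g i \<in> J" if "i \<in> I" for i
    using that inj by (auto simp: J_def k_def)
  define G where "G = F \<circ> k"
  define t where "t u = (\<lambda>a\<in>J. u (k a))" for u :: "'i \<Rightarrow> 'b"
  have t1: "t u \<in> carrier (direct_sum J G)" if u: "u \<in> carrier (direct_sum I F)" for u
  proof -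
    have "{a \<in> J. t u a \<noteq> \<zero>\<^bsub>G a\<^esub>} \<subseteq> g ` {i \<in> I. u i \<noteq> \<zero>\<^bsub>F i\<^esub>}"
    proof
      fix a assume "a \<in> {a \<in> J. t u a \<noteq> \<zero>\<^bsub>G a\<^esub>}"
      then have "a \<in> J" "u (k a) \<noteq> \<zero>\<^bsub>F (k a)\<^esub>" by (auto simp: t_def G_def)
      then show "a \<in> g ` {i \<in> I. u i \<noteq> \<zero>\<^bsub>F i\<^esub>}"
        using k by (intro image_eqI[of _ _ "k a"]) auto
    qed
    moreover have "finite {i \<in> I. u i \<noteq> \<zero>\<^bsub>F i\<^esub>}" using u by (simp add: direct_sum_def)
    ultimately have "finite {a \<in> J. t u a \<noteq> \<zero>\<^bsub>G a\<^esub>}" by (meson finite_imageI finite_subset)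
    moreover have "t u \<in> (\<Pi>\<^sub>E a\<in>J. carrier (G a))"
      using u k by (auto simp: t_def G_def direct_sum_def)
    ultimately show ?thesis by (simp add: direct_sum_def)
  qed
  have bij: "bij_betw t (carrier (direct_sum I F)) (carrier (direct_sum J G))"
  proof (rule bij_betw_byWitness[where f' = "\<lambda>v. \<lambda>i\<in>I. v (g i)"])
    show "\<forall>u\<in>carrier (direct_sum I F). (\<lambda>i\<in>I. t u (g i)) = u"
      by (auto simp: direct_sum_def t_def kg fun_eq_iff PiE_def extensional_def)
    show "\<forall>v\<in>carrier (direct_sum J G). t (\<lambda>i\<in>I. v (g i)) = v"
      by (auto simp: direct_sum_def t_def k fun_eq_iff PiE_def extensional_def)
    show "t ` carrier (direct_sum I F) \<subseteq> carrier (direct_sum J G)" using t1 by auto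
    show "(\<lambda>v. \<lambda>i\<in>I. v (g i)) ` carrier (direct_sum J G) \<subseteq> carrier (direct_sum I F)"
    proof
      fix w assume "w \<in> (\<lambda>v. \<lambda>i\<in>I. v (g i)) ` carrier (direct_sum J G)"
      then obtain v where v: "v \<in> carrier (direct_sum J G)" and w: "w = (\<lambda>i\<in>I. v (g i))"
        by auto
      have "{i \<in> I. w i \<noteq> \<zero>\<^bsub>F i\<^esub>} \<subseteq> k ` {a \<in> J. v a \<noteq> \<zero>\<^bsub>G a\<^esub>}"
      proof
        fix i assume "i \<in> {i \<in> I. w i \<noteq> \<zero>\<^bsub>F i\<^esub>}"
        then have "i \<in> I" "v (g i) \<noteq> \<zero>\<^bsub>F i\<^esub>" by (auto simp: w)
        then show "i \<in> k ` {a \<in> J. v a \<noteq> \<zero>\<^bsub>G a\<^esub>}"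
          using kg by (intro image_eqI[of _ _ "g i"]) (auto simp: G_def)
      qed
      moreover have "finite {a \<in> J. v a \<noteq> \<zero>\<^bsub>G a\<^esub>}" using v by (simp add: direct_sum_def)
      ultimately have "finite {i \<in> I. w i \<noteq> \<zero>\<^bsub>F i\<^esub>}" by (meson finite_imageI finite_subset)
      moreover have "w \<in> (\<Pi>\<^sub>E i\<in>I. carrier (F i))"
      proof -
        have "v (g i) \<in> carrier (F i)" if "i \<in> I" for i
        proof -
          have "v (g i) \<in> carrier (G (g i))"
            using v kg(2)[OF that] by (auto simp: direct_sum_def)
          then show ?thesis using kg(1)[OF that] by (simp add: G_def)
        qed
        then show ?thesis by (auto simp: w)
      qed
      ultimately show "w \<in> carrier (direct_sum I F)" by (simp add: direct_sum_def)
    qed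
  qed
  have "t \<circ> h \<in> lm_hom R M (direct_sum J G)"
    using h(1) t1 k by (auto simp: lm_hom_def direct_sum_def t_def G_def fun_eq_iff Pi_iff)
  moreover have "bij_betw (t \<circ> h) (carrier M) (carrier (direct_sum J G))"
    using bij_betw_trans[OF h(2) bij] .
  moreover have "G \<in> J \<rightarrow> \<X>" using F k by (auto simp: G_def)
  ultimately show ?thesis
    using M unfolding X_semisimple_def lm_isomorphic_def by blast
qed

end

theory Submission
  imports Defs
begin

text \<open>
  Bricks are finitely generated, so a nonzero map \<open>f : X \<rightarrow> M\<close> from a brick lands in some
  \<open>M\<^bsub>\<lambda>+1\<^esub>\<close> but not in \<open>M\<^bsub>\<lambda>\<^esub>\<close>, and the semibrick property makes the composite
  \<open>X \<rightarrow> M\<^bsub>\<lambda>+1\<^esub> / M\<^bsub>\<lambda>\<^esub>\<close> an isomorphism. Choose one such map \<open>f\<^bsub>\<lambda>\<^esub>\<close> for every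
  \<open>\<lambda>\<close> at which one exists. Comparing the terms of highest index shows that the sum of the images
  of the \<open>f\<^bsub>\<lambda>\<^esub>\<close> is direct. It is all of the trace: given \<open>f\<close> at level \<open>\<lambda>\<close>, subtracting
  \<open>f\<^bsub>\<lambda>\<^esub>\<close> composed with a suitable automorphism of \<open>X\<close> lowers the level, and one concludes by
  transfinite induction.
\<close>

section \<open>Left modules and their homomorphisms\<close>

lemma (in left_module) smult_zero_right:
  assumes "a \<in> carrier R"
  shows "a \<odot>\<^bsub>M\<^esub> \<zero>\<^bsub>M\<^esub> = \<zero>\<^bsub>M\<^esub>"
proof -
  have "a \<odot>\<^bsub>M\<^esub> \<zero>\<^bsub>M\<^esub> \<oplus>\<^bsub>M\<^esub> a \<odot>\<^bsub>M\<^esub> \<zero>\<^bsub>M\<^esub> = a \<odot>\<^bsub>M\<^esub> \<zero>\<^bsub>M\<^esub>"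
    using smult_r_distr[of a "\<zero>\<^bsub>M\<^esub>" "\<zero>\<^bsub>M\<^esub>"] assms by simp
  then show ?thesis
    using assms M.add.r_cancel_one' by (metis M.zero_closed smult_closed)
qed

lemma (in left_module) smult_minus_right:
  assumes "a \<in> carrier R" "x \<in> carrier M"
  shows "a \<odot>\<^bsub>M\<^esub> (\<ominus>\<^bsub>M\<^esub> x) = \<ominus>\<^bsub>M\<^esub> (a \<odot>\<^bsub>M\<^esub> x)"
proof -
  have "a \<odot>\<^bsub>M\<^esub> (\<ominus>\<^bsub>M\<^esub> x) \<oplus>\<^bsub>M\<^esub> a \<odot>\<^bsub>M\<^esub> x = \<zero>\<^bsub>M\<^esub>"
    using smult_r_distr[of a "\<ominus>\<^bsub>M\<^esub> x" x] assms by (simp add: M.l_neg smult_zero_right)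
  then show ?thesis
    using assms by (intro M.minus_equality[symmetric]) auto
qed

text \<open>The \<open>submodule\<close> locale builds on \<open>subgroup\<close> for the additive
  monoid in multiplicative notation. This rule and its converse \<open>submoduleD\<close> translate
  between that form and \<open>\<zero>\<close>, \<open>\<ominus>\<close>,
  \<open>\<oplus>\<close>.\<close>

lemma (in left_module) submoduleI:
  assumes "H \<subseteq> carrier M" "\<zero>\<^bsub>M\<^esub> \<in> H"
    and "\<And>x. x \<in> H \<Longrightarrow> \<ominus>\<^bsub>M\<^esub> x \<in> H"
    and "\<And>x y. x \<in> H \<Longrightarrow> y \<in> H \<Longrightarrow> x \<oplus>\<^bsub>M\<^esub> y \<in> H"
    and "\<And>a x. a \<in> carrier R \<Longrightarrow> x \<in> H \<Longrightarrow> a \<odot>\<^bsub>M\<^esub> x \<in> H"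
  shows "submodule H R M"
  using assms
  by (intro submodule.intro subgroup.intro) (auto simp: submodule_axioms_def a_inv_def)

lemma (in left_module) submoduleD:
  assumes "submodule H R M"
  shows "H \<subseteq> carrier M" "\<zero>\<^bsub>M\<^esub> \<in> H"
    and "\<And>x. x \<in> H \<Longrightarrow> \<ominus>\<^bsub>M\<^esub> x \<in> H"
    and "\<And>x y. x \<in> H \<Longrightarrow> y \<in> H \<Longrightarrow> x \<oplus>\<^bsub>M\<^esub> y \<in> H"
    and "\<And>a x. a \<in> carrier R \<Longrightarrow> x \<in> H \<Longrightarrow> a \<odot>\<^bsub>M\<^esub> x \<in> H"
proof -
  interpret H: submodule H R M by fact
  show "H \<subseteq> carrier M" using H.subset by simp
  show "\<zero>\<^bsub>M\<^esub> \<in> H" using H.one_closed by simp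
  show "\<ominus>\<^bsub>M\<^esub> x \<in> H" if "x \<in> H" for x
    using H.m_inv_closed[OF that] by (simp add: a_inv_def)
  show "x \<oplus>\<^bsub>M\<^esub> y \<in> H" if "x \<in> H" "y \<in> H" for x y
    using H.m_closed[OF that] by simp
  show "a \<odot>\<^bsub>M\<^esub> x \<in> H" if "a \<in> carrier R" "x \<in> H" for a x
    using that by (rule H.smult_closed)
qed

lemma (in left_module) submodule_carrier: "submodule (carrier M) R M"
  by (rule submoduleI) auto

lemma (in left_module) submodule_finsum:
  assumes H: "submodule H R M" and "\<And>i. i \<in> A \<Longrightarrow> f i \<in> H"
  shows "finsum M f A \<in> H"
proof (cases "finite A")
  case True
  then show ?thesis using assms(2)
  proof (induction A)
    case empty
    then show ?case using submoduleD(2)[OF H] by simp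
  next
    case (insert i A)
    have "f \<in> A \<rightarrow> carrier M" "f i \<in> carrier M"
      using insert.prems submoduleD(1)[OF H] by auto
    then show ?case
      using insert submoduleD(4)[OF H] by simp
  qed
next
  \<comment> \<open>A sum over an infinite index set is zero by convention, and zero lies in every
    submodule.\<close>
  case False
  then show ?thesis using submoduleD(2)[OF H] by (simp add: M.finsum_infinite)
qed

lemma (in left_module) smult_finsum:
  assumes a: "a \<in> carrier R" and "f \<in> A \<rightarrow> carrier M"
  shows "a \<odot>\<^bsub>M\<^esub> finsum M f A = finsum M (\<lambda>i. a \<odot>\<^bsub>M\<^esub> f i) A"
proof (cases "finite A")
  case True
  then show ?thesis using assms(2)
  proof (induction A)
    case empty
    then show ?case using a by (simp add: smult_zero_right)
  next
    case (insert i A)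
    then have "f \<in> A \<rightarrow> carrier M" "f i \<in> carrier M" by auto
    moreover from this have "(\<lambda>i. a \<odot>\<^bsub>M\<^esub> f i) \<in> A \<rightarrow> carrier M" using a by auto
    ultimately show ?case
      using insert a by (simp add: smult_r_distr)
  qed
next
  case False
  then show ?thesis using a by (simp add: M.finsum_infinite smult_zero_right)
qed

section \<open>Homomorphisms, their images and preimages\<close>

lemma lm_homI:
  assumes "\<And>x. x \<in> carrier M \<Longrightarrow> f x \<in> carrier N"
    and "\<And>x y. x \<in> carrier M \<Longrightarrow> y \<in> carrier M \<Longrightarrow> f (x \<oplus>\<^bsub>M\<^esub> y) = f x \<oplus>\<^bsub>N\<^esub> f y"
    and "\<And>a x. a \<in> carrier R \<Longrightarrow> x \<in> carrier M \<Longrightarrow> f (a \<odot>\<^bsub>M\<^esub> x) = a \<odot>\<^bsub>N\<^esub> f x"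
  shows "f \<in> lm_hom R M N"
  using assms by (auto simp: lm_hom_def)

lemma lm_homD:
  assumes "f \<in> lm_hom R M N"
  shows "\<And>x. x \<in> carrier M \<Longrightarrow> f x \<in> carrier N"
    and "\<And>x y. x \<in> carrier M \<Longrightarrow> y \<in> carrier M \<Longrightarrow> f (x \<oplus>\<^bsub>M\<^esub> y) = f x \<oplus>\<^bsub>N\<^esub> f y"
    and "\<And>a x. a \<in> carrier R \<Longrightarrow> x \<in> carrier M \<Longrightarrow> f (a \<odot>\<^bsub>M\<^esub> x) = a \<odot>\<^bsub>N\<^esub> f x"
  using assms by (auto simp: lm_hom_def)

lemma lm_hom_zero:
  assumes "left_module R M" "left_module R N" "f \<in> lm_hom R M N"
  shows "f \<zero>\<^bsub>M\<^esub> = \<zero>\<^bsub>N\<^esub>"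
proof -
  interpret M: left_module R M by fact
  interpret N: left_module R N by fact
  have "f \<zero>\<^bsub>M\<^esub> \<oplus>\<^bsub>N\<^esub> f \<zero>\<^bsub>M\<^esub> = f \<zero>\<^bsub>M\<^esub>"
    using lm_homD(2)[OF assms(3), of "\<zero>\<^bsub>M\<^esub>" "\<zero>\<^bsub>M\<^esub>"] by simp
  then show ?thesis
    using N.M.add.r_cancel_one' lm_homD(1)[OF assms(3) M.M.zero_closed] by metis
qed

lemma lm_hom_uminus:
  assumes "left_module R M" "left_module R N" "f \<in> lm_hom R M N" "x \<in> carrier M"
  shows "f (\<ominus>\<^bsub>M\<^esub> x) = \<ominus>\<^bsub>N\<^esub> f x"
proof -
  interpret M: left_module R M by fact
  interpret N: left_module R N by fact
  have "f (\<ominus>\<^bsub>M\<^esub> x) \<oplus>\<^bsub>N\<^esub> f x = f (\<ominus>\<^bsub>M\<^esub> x \<oplus>\<^bsub>M\<^esub> x)"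
    using assms(4) by (simp add: lm_homD(2)[OF assms(3)])
  also have "\<dots> = \<zero>\<^bsub>N\<^esub>"
    using assms(4) lm_hom_zero[OF assms(1-3)] by (simp add: M.M.l_neg)
  finally show ?thesis
    using assms(4) by (intro N.M.minus_equality[symmetric]) (auto intro: lm_homD(1)[OF assms(3)])
qed

lemma lm_hom_inj_onI:
  assumes M: "left_module R M" and N: "left_module R N" and f: "f \<in> lm_hom R M N"
    and ker: "\<And>x. x \<in> carrier M \<Longrightarrow> f x = \<zero>\<^bsub>N\<^esub> \<Longrightarrow> x = \<zero>\<^bsub>M\<^esub>"
  shows "inj_on f (carrier M)"
proof (rule inj_onI)
  interpret M: left_module R M by fact
  interpret N: left_module R N by fact
  fix x y assume xy: "x \<in> carrier M" "y \<in> carrier M" "f x = f y"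
  have "f (x \<oplus>\<^bsub>M\<^esub> \<ominus>\<^bsub>M\<^esub> y) = \<zero>\<^bsub>N\<^esub>"
    using xy lm_homD(1)[OF f]
    by (simp add: lm_homD(2)[OF f] lm_hom_uminus[OF M N f] N.M.r_neg)
  then have "x \<oplus>\<^bsub>M\<^esub> \<ominus>\<^bsub>M\<^esub> y = \<zero>\<^bsub>M\<^esub>" using ker xy by simp
  then have "\<ominus>\<^bsub>M\<^esub> (\<ominus>\<^bsub>M\<^esub> y) = x" using xy by (intro M.M.minus_equality) auto
  then show "x = y" using xy by simp
qed

lemma lm_hom_comp:
  assumes "f \<in> lm_hom R L M" "g \<in> lm_hom R M N"
  shows "(\<lambda>x. g (f x)) \<in> lm_hom R L N"
  using assms by (auto simp: lm_hom_def Pi_iff)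

lemma lm_hom_diff:
  assumes N: "left_module R N" and f: "f \<in> lm_hom R M N" and g: "g \<in> lm_hom R M N"
  shows "(\<lambda>x. f x \<ominus>\<^bsub>N\<^esub> g x) \<in> lm_hom R M N"
proof (rule lm_homI)
  interpret N: left_module R N by fact
  note c = lm_homD(1)[OF f] lm_homD(1)[OF g]
  show "f x \<ominus>\<^bsub>N\<^esub> g x \<in> carrier N" if "x \<in> carrier M" for x using that c by simp
  show "f (x \<oplus>\<^bsub>M\<^esub> y) \<ominus>\<^bsub>N\<^esub> g (x \<oplus>\<^bsub>M\<^esub> y) = (f x \<ominus>\<^bsub>N\<^esub> g x) \<oplus>\<^bsub>N\<^esub> (f y \<ominus>\<^bsub>N\<^esub> g y)"
    if "x \<in> carrier M" "y \<in> carrier M" for x y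
    using that c
    by (simp add: lm_homD(2)[OF f] lm_homD(2)[OF g] a_minus_def N.M.minus_add N.M.a_ac)
  show "f (a \<odot>\<^bsub>M\<^esub> x) \<ominus>\<^bsub>N\<^esub> g (a \<odot>\<^bsub>M\<^esub> x) = a \<odot>\<^bsub>N\<^esub> (f x \<ominus>\<^bsub>N\<^esub> g x)"
    if "a \<in> carrier R" "x \<in> carrier M" for a x
    using that c
    by (simp add: lm_homD(3)[OF f] lm_homD(3)[OF g] a_minus_def N.smult_r_distr
        N.smult_minus_right)
qed

text \<open>Pulled back along a map from a brick, a step of the filtration becomes a submodule of
  the brick that can be tested on generators.\<close>

lemma submodule_vimage:
  assumes M: "left_module R M" and N: "left_module R N" and f: "f \<in> lm_hom R M N"
    and H: "submodule H R N"
  shows "submodule {x \<in> carrier M. f x \<in> H} R M"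
proof -
  interpret M: left_module R M by fact
  interpret N: left_module R N by fact
  show ?thesis
    by (rule M.submoduleI)
      (auto simp: lm_homD[OF f] lm_hom_zero[OF M N f] lm_hom_uminus[OF M N f]
        N.submoduleD[OF H])
qed

lemma submodule_image:
  assumes M: "left_module R M" and N: "left_module R N" and f: "f \<in> lm_hom R M N"
  shows "submodule (f ` carrier M) R N"
proof -
  interpret M: left_module R M by fact
  interpret N: left_module R N by fact
  show ?thesis
  proof (rule N.submoduleI)
    show "f ` carrier M \<subseteq> carrier N" using lm_homD(1)[OF f] by auto
    show "\<zero>\<^bsub>N\<^esub> \<in> f ` carrier M"
      by (intro image_eqI[of _ _ "\<zero>\<^bsub>M\<^esub>"]) (simp_all add: lm_hom_zero[OF M N f])
    show "\<ominus>\<^bsub>N\<^esub> x \<in> f ` carrier M" if "x \<in> f ` carrier M" for x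
      using that by (auto simp: lm_hom_uminus[OF M N f, symmetric])
    show "x \<oplus>\<^bsub>N\<^esub> y \<in> f ` carrier M" if "x \<in> f ` carrier M" "y \<in> f ` carrier M" for x y
      using that by (auto simp: lm_homD(2)[OF f, symmetric])
    show "a \<odot>\<^bsub>N\<^esub> x \<in> f ` carrier M" if "a \<in> carrier R" "x \<in> f ` carrier M" for a x
      using that by (auto simp: lm_homD(3)[OF f, symmetric])
  qed
qed

text \<open>\<open>lm_isomorphic\<close> supplies a map in one direction only; this lemma reverses
  it. Each law is checked by writing the arguments as values of \<open>f\<close> and
  cancelling.\<close>

lemma lm_hom_inv_into:
  assumes M: "left_module R M" and f: "f \<in> lm_hom R M N"
    and bij: "bij_betw f (carrier M) (carrier N)"
  shows "inv_into (carrier M) f \<in> lm_hom R N M"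
proof (rule lm_homI)
  interpret M: left_module R M by fact
  let ?g = "inv_into (carrier M) f"
  have g: "?g y \<in> carrier M" "f (?g y) = y" if "y \<in> carrier N" for y
    using that bij by (auto simp: bij_betw_def inv_into_into f_inv_into_f)
  have gf: "?g (f x) = x" if "x \<in> carrier M" for x
    using that bij by (auto simp: bij_betw_def)
  show "?g x \<in> carrier M" if "x \<in> carrier N" for x using g that by blast
  show "?g (x \<oplus>\<^bsub>N\<^esub> y) = ?g x \<oplus>\<^bsub>M\<^esub> ?g y" if "x \<in> carrier N" "y \<in> carrier N" for x y
    using gf[of "?g x \<oplus>\<^bsub>M\<^esub> ?g y"] g[OF that(1)] g[OF that(2)] by (simp add: lm_homD(2)[OF f])
  show "?g (a \<odot>\<^bsub>N\<^esub> x) = a \<odot>\<^bsub>M\<^esub> ?g x" if "a \<in> carrier R" "x \<in> carrier N" for a x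
    using gf[of "a \<odot>\<^bsub>M\<^esub> ?g x"] g[OF that(2)] that(1) by (simp add: lm_homD(3)[OF f])
qed

text \<open>The map \<open>p\<close> is the coset projection followed by the given isomorphism; its
  kernel is \<open>H\<close> because the isomorphism is injective. Phrasing this for elements of
  \<open>N\<close> lets the later arguments avoid cosets.\<close>

lemma quot_module_iso_lift:
  assumes M: "left_module R M" and X: "left_module R X"
    and N: "submodule N R M" and H: "submodule H R M"
    and iso: "lm_isomorphic R (quot_module M N H) X"
  obtains p where "p \<in> lm_hom R (M\<lparr>carrier := N\<rparr>) X"
    and "\<And>x. x \<in> N \<Longrightarrow> p x = \<zero>\<^bsub>X\<^esub> \<longleftrightarrow> x \<in> H"
proof -
  interpret M: left_module R M by fact
  interpret X: left_module R X by fact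
  interpret H: submodule H R M by fact
  interpret A: abelian_subgroup H M
    by (rule abelian_subgroupI2[OF M.M.a_comm_group H.subgroup_axioms])
  obtain h where h: "h \<in> lm_hom R (quot_module M N H) X"
      "bij_betw h (carrier (quot_module M N H)) (carrier X)"
    using iso by (auto simp: lm_isomorphic_def)
  note NM = M.submoduleD[OF N] and HM = M.submoduleD[OF H]
  have car: "carrier (quot_module M N H) = (\<lambda>x. H +>\<^bsub>M\<^esub> x) ` N"
    by (auto simp: quot_module_def A_RCOSETS_def RCOSETS_def r_coset_def a_r_coset_def)
  \<comment> \<open>Scalar multiplication of a coset is a union over its representatives. Since
    \<open>H\<close> is closed under scalars, every representative yields the same coset, and the
    union collapses to it.\<close>
  have sm: "a \<odot>\<^bsub>quot_module M N H\<^esub> (H +>\<^bsub>M\<^esub> x) = H +>\<^bsub>M\<^esub> (a \<odot>\<^bsub>M\<^esub> x)"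
    if a: "a \<in> carrier R" and x: "x \<in> carrier M" for a x
  proof -
    have eq: "H +>\<^bsub>M\<^esub> (a \<odot>\<^bsub>M\<^esub> y) = H +>\<^bsub>M\<^esub> (a \<odot>\<^bsub>M\<^esub> x)" if y: "y \<in> H +>\<^bsub>M\<^esub> x" for y
    proof -
      obtain z where z: "z \<in> H" "y = z \<oplus>\<^bsub>M\<^esub> x"
        using y by (auto simp: a_r_coset_def r_coset_def)
      have "a \<odot>\<^bsub>M\<^esub> y = a \<odot>\<^bsub>M\<^esub> z \<oplus>\<^bsub>M\<^esub> a \<odot>\<^bsub>M\<^esub> x"
        using z HM(1) a x by (auto intro: M.smult_r_distr)
      then have "a \<odot>\<^bsub>M\<^esub> y \<in> H +>\<^bsub>M\<^esub> (a \<odot>\<^bsub>M\<^esub> x)"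
        using HM(5)[OF a z(1)] by (auto simp: a_r_coset_def r_coset_def)
      then show ?thesis
        using A.a_repr_independence' a x by (metis M.smult_closed)
    qed
    have "(\<Union>y\<in>H +>\<^bsub>M\<^esub> x. H +>\<^bsub>M\<^esub> (a \<odot>\<^bsub>M\<^esub> y)) = (\<Union>y\<in>H +>\<^bsub>M\<^esub> x. H +>\<^bsub>M\<^esub> (a \<odot>\<^bsub>M\<^esub> x))"
      by (rule SUP_cong[OF refl eq])
    also have "\<dots> = H +>\<^bsub>M\<^esub> (a \<odot>\<^bsub>M\<^esub> x)"
      using A.a_rcos_self[OF x] by (intro SUP_const) blast
    finally show ?thesis by (simp only: quot_module_def module.simps)
  qed
  have ad: "(H +>\<^bsub>M\<^esub> x) \<oplus>\<^bsub>quot_module M N H\<^esub> (H +>\<^bsub>M\<^esub> y) = H +>\<^bsub>M\<^esub> (x \<oplus>\<^bsub>M\<^esub> y)"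
    if "x \<in> carrier M" "y \<in> carrier M" for x y
    using A.a_rcos_sum[OF that] by (simp add: quot_module_def)
  define p where "p x = h (H +>\<^bsub>M\<^esub> x)" for x
  have pc: "p x \<in> carrier X" if "x \<in> N" for x
    using that lm_homD(1)[OF h(1)] by (simp add: p_def car)
  have pa: "p (x \<oplus>\<^bsub>M\<^esub> y) = p x \<oplus>\<^bsub>X\<^esub> p y" if "x \<in> N" "y \<in> N" for x y
  proof -
    have "p (x \<oplus>\<^bsub>M\<^esub> y) = h ((H +>\<^bsub>M\<^esub> x) \<oplus>\<^bsub>quot_module M N H\<^esub> (H +>\<^bsub>M\<^esub> y))"
      using that NM(1) by (subst ad) (auto simp: p_def)
    also have "\<dots> = p x \<oplus>\<^bsub>X\<^esub> p y"
      using that by (simp add: p_def car lm_homD(2)[OF h(1)])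
    finally show ?thesis .
  qed
  have ps: "p (a \<odot>\<^bsub>M\<^esub> x) = a \<odot>\<^bsub>X\<^esub> p x" if "a \<in> carrier R" "x \<in> N" for a x
  proof -
    have "p (a \<odot>\<^bsub>M\<^esub> x) = h (a \<odot>\<^bsub>quot_module M N H\<^esub> (H +>\<^bsub>M\<^esub> x))"
      using that NM(1) by (subst sm) (auto simp: p_def)
    also have "\<dots> = a \<odot>\<^bsub>X\<^esub> p x"
      using that by (simp add: p_def car lm_homD(3)[OF h(1)])
    finally show ?thesis .
  qed
  \<comment> \<open>The value of \<open>p\<close> at zero equals its own double, so cancellation in
    \<open>X\<close> makes it zero.\<close>
  have p0: "p \<zero>\<^bsub>M\<^esub> = \<zero>\<^bsub>X\<^esub>"
    using pa[of "\<zero>\<^bsub>M\<^esub>" "\<zero>\<^bsub>M\<^esub>"] pc[of "\<zero>\<^bsub>M\<^esub>"] NM(2) X.M.add.r_cancel_one'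
    by (metis M.M.zero_closed M.M.l_zero)
  show thesis
  proof
    show "p \<in> lm_hom R (M\<lparr>carrier := N\<rparr>) X"
      by (rule lm_homI) (simp_all add: pc pa ps)
  next
    fix x assume x: "x \<in> N"
    have "p x = \<zero>\<^bsub>X\<^esub> \<longleftrightarrow> h (H +>\<^bsub>M\<^esub> x) = h (H +>\<^bsub>M\<^esub> \<zero>\<^bsub>M\<^esub>)"
      using p0 by (simp add: p_def)
    also have "\<dots> \<longleftrightarrow> H +>\<^bsub>M\<^esub> x = H +>\<^bsub>M\<^esub> \<zero>\<^bsub>M\<^esub>"
      using h(2) x NM(2) by (intro inj_on_eq_iff[of h]) (auto simp: bij_betw_def car)
    also have "\<dots> \<longleftrightarrow> H +>\<^bsub>M\<^esub> x = H"
      using A.a_rcos_const[OF HM(2)] by simp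
    also have "\<dots> \<longleftrightarrow> x \<in> H"
      using A.a_rcos_const A.a_rcos_self NM(1) x by auto
    finally show "p x = \<zero>\<^bsub>X\<^esub> \<longleftrightarrow> x \<in> H" .
  qed
qed

section \<open>Maps between members of a semibrick\<close>

lemma semibrick_left_module:
  assumes "semibrick R \<X>" "X \<in> \<X>"
  shows "left_module R X"
  using assms by (auto simp: semibrick_def brick_def)

text \<open>A form of Schur's lemma. Vanishing of Hom between distinct members forces
  \<open>Y = X\<close>, so \<open>f\<close> gives a nonzero element of the division ring
  \<open>End_ring R X\<close>, and \<open>g\<close> is its inverse there.\<close>

lemma semibrick_nonzero_hom_iso:
  assumes S: "semibrick R \<X>" and X: "X \<in> \<X>" "Y \<in> \<X>"
    and f: "f \<in> lm_hom R X Y" and x: "x \<in> carrier X" "f x \<noteq> \<zero>\<^bsub>Y\<^esub>"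
  obtains g where "Y = X" "g \<in> lm_hom R X X"
    "\<And>x. x \<in> carrier X \<Longrightarrow> g (f x) = x" "\<And>x. x \<in> carrier X \<Longrightarrow> f (g x) = x"
proof -
  have Y: "Y = X"
    using S X f x unfolding semibrick_def hom_zero_def by metis
  \<comment> \<open>Elements of \<open>End_ring\<close> are extensional on the carrier, so
    \<open>f\<close> must be restricted before it counts as a ring element.\<close>
  let ?E = "End_ring R X" and ?f = "restrict f (carrier X)"
  interpret X: left_module R X using semibrick_left_module[OF S X(1)] .
  interpret E: div_ring ?E using S X by (auto simp: semibrick_def brick_def)
  have "?f \<in> lm_hom R X X"
    using f Y by (auto simp: lm_hom_def)
  then have "?f \<in> carrier ?E" by (simp add: End_ring_def)
  moreover have "?f \<noteq> \<zero>\<^bsub>?E\<^esub>"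
  proof
    assume "?f = \<zero>\<^bsub>?E\<^esub>"
    then have "?f x = \<zero>\<^bsub>X\<^esub>" using x(1) by (simp add: End_ring_def)
    then show False using x Y by simp
  qed
  ultimately have "?f \<in> Units ?E" using E.div_Units by blast
  then obtain g where g: "g \<in> carrier ?E" "g \<otimes>\<^bsub>?E\<^esub> ?f = \<one>\<^bsub>?E\<^esub>" "?f \<otimes>\<^bsub>?E\<^esub> g = \<one>\<^bsub>?E\<^esub>"
    by (auto simp: Units_def)
  have gh: "g \<in> lm_hom R X X" using g(1) by (simp add: End_ring_def)
  have "g (f x) = x" if "x \<in> carrier X" for x
    using fun_cong[OF g(2), of x] that by (simp add: End_ring_def compose_def)
  moreover have "f (g x) = x" if "x \<in> carrier X" for x
    using fun_cong[OF g(3), of x] that lm_homD(1)[OF gh that]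
    by (simp add: End_ring_def compose_def)
  ultimately show thesis using that Y gh by blast
qed

section \<open>Direct sums\<close>

lemma direct_sum_simps:
  "\<zero>\<^bsub>direct_sum I F\<^esub> = (\<lambda>i\<in>I. \<zero>\<^bsub>F i\<^esub>)"
  "u \<oplus>\<^bsub>direct_sum I F\<^esub> v = (\<lambda>i\<in>I. u i \<oplus>\<^bsub>F i\<^esub> v i)"
  "a \<odot>\<^bsub>direct_sum I F\<^esub> u = (\<lambda>i\<in>I. a \<odot>\<^bsub>F i\<^esub> u i)"
  by (simp_all add: direct_sum_def)

lemma direct_sum_memI:
  assumes "u \<in> extensional I" "\<And>i. i \<in> I \<Longrightarrow> u i \<in> carrier (F i)"
    and "finite S" "\<And>i. i \<in> I \<Longrightarrow> i \<notin> S \<Longrightarrow> u i = \<zero>\<^bsub>F i\<^esub>"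
  shows "u \<in> carrier (direct_sum I F)"
proof -
  have "{i \<in> I. u i \<noteq> \<zero>\<^bsub>F i\<^esub>} \<subseteq> S" using assms(4) by auto
  then show ?thesis
    using assms(1-3) finite_subset by (auto simp: direct_sum_def PiE_def)
qed

lemma direct_sum_memD:
  assumes "u \<in> carrier (direct_sum I F)"
  shows "u \<in> extensional I" "\<And>i. i \<in> I \<Longrightarrow> u i \<in> carrier (F i)"
    and "finite {i \<in> I. u i \<noteq> \<zero>\<^bsub>F i\<^esub>}"
  using assms by (auto simp: direct_sum_def PiE_def)

text \<open>The laws hold coordinatewise. Finite support survives because the support of a sum lies
  in the union of the two supports, while scalars and negation do not enlarge a support.\<close>

lemma left_module_direct_sum:
  fixes F :: "'i \<Rightarrow> ('r, 'x) module"
  assumes R: "ring R" and F: "\<And>i. i \<in> I \<Longrightarrow> left_module R (F i)"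
  shows "left_module R (direct_sum I F)"
proof -
  let ?D = "direct_sum I F"
  note D = direct_sum_memD
  have ext: "u = v" if "u \<in> extensional I" "v \<in> extensional I" "\<And>i. i \<in> I \<Longrightarrow> u i = v i"
    for u v :: "'i \<Rightarrow> 'x"
    using that by (rule extensionalityI)
  have zc: "\<zero>\<^bsub>F i\<^esub> \<in> carrier (F i)" and zz: "\<zero>\<^bsub>F i\<^esub> \<oplus>\<^bsub>F i\<^esub> \<zero>\<^bsub>F i\<^esub> = \<zero>\<^bsub>F i\<^esub>"
    if "i \<in> I" for i
  proof -
    interpret left_module R "F i" using F that .
    show "\<zero>\<^bsub>F i\<^esub> \<in> carrier (F i)" "\<zero>\<^bsub>F i\<^esub> \<oplus>\<^bsub>F i\<^esub> \<zero>\<^bsub>F i\<^esub> = \<zero>\<^bsub>F i\<^esub>" by simp_all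
  qed
  have add: "u \<oplus>\<^bsub>?D\<^esub> v \<in> carrier ?D" if u: "u \<in> carrier ?D" and v: "v \<in> carrier ?D" for u v
  proof (rule direct_sum_memI[where S = "{i \<in> I. u i \<noteq> \<zero>\<^bsub>F i\<^esub>} \<union> {i \<in> I. v i \<noteq> \<zero>\<^bsub>F i\<^esub>}"])
    show "(u \<oplus>\<^bsub>?D\<^esub> v) i \<in> carrier (F i)" if i: "i \<in> I" for i
    proof -
      interpret left_module R "F i" using F i .
      show ?thesis using i D(2)[OF u] D(2)[OF v] by (simp add: direct_sum_simps)
    qed
  qed (use D(3)[OF u] D(3)[OF v] zz in \<open>auto simp: direct_sum_simps\<close>)
  have smult: "a \<odot>\<^bsub>?D\<^esub> u \<in> carrier ?D" if a: "a \<in> carrier R" and u: "u \<in> carrier ?D" for a u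
  proof (rule direct_sum_memI[where S = "{i \<in> I. u i \<noteq> \<zero>\<^bsub>F i\<^esub>}"])
    show "(a \<odot>\<^bsub>?D\<^esub> u) i \<in> carrier (F i)" if i: "i \<in> I" for i
    proof -
      interpret left_module R "F i" using F i .
      show ?thesis using i D(2)[OF u] a by (simp add: direct_sum_simps)
    qed
  qed (use D(3)[OF u] left_module.smult_zero_right[OF F a] in \<open>auto simp: direct_sum_simps\<close>)
  have zero: "\<zero>\<^bsub>?D\<^esub> \<in> carrier ?D"
    by (rule direct_sum_memI[where S = "{}"]) (auto simp: direct_sum_simps zc)
  have abel: "abelian_group ?D"
  proof (rule abelian_groupI)
    fix u v w assume uvw: "u \<in> carrier ?D" "v \<in> carrier ?D" "w \<in> carrier ?D"
    show "(u \<oplus>\<^bsub>?D\<^esub> v) \<oplus>\<^bsub>?D\<^esub> w = u \<oplus>\<^bsub>?D\<^esub> (v \<oplus>\<^bsub>?D\<^esub> w)"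
    proof (rule ext)
      fix i assume i: "i \<in> I"
      then interpret left_module R "F i" by (rule F)
      show "((u \<oplus>\<^bsub>?D\<^esub> v) \<oplus>\<^bsub>?D\<^esub> w) i = (u \<oplus>\<^bsub>?D\<^esub> (v \<oplus>\<^bsub>?D\<^esub> w)) i"
        using i D(2)[OF uvw(1) i] D(2)[OF uvw(2) i] D(2)[OF uvw(3) i]
        by (simp add: direct_sum_simps M.a_assoc)
    qed (simp_all add: direct_sum_simps)
  next
    fix u v assume uv: "u \<in> carrier ?D" "v \<in> carrier ?D"
    show "u \<oplus>\<^bsub>?D\<^esub> v = v \<oplus>\<^bsub>?D\<^esub> u"
    proof (rule ext)
      fix i assume i: "i \<in> I"
      then interpret left_module R "F i" by (rule F)
      show "(u \<oplus>\<^bsub>?D\<^esub> v) i = (v \<oplus>\<^bsub>?D\<^esub> u) i"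
        using i D(2)[OF uv(1) i] D(2)[OF uv(2) i] by (simp add: direct_sum_simps M.a_comm)
    qed (simp_all add: direct_sum_simps)
  next
    fix u assume u: "u \<in> carrier ?D"
    show "\<zero>\<^bsub>?D\<^esub> \<oplus>\<^bsub>?D\<^esub> u = u"
    proof (rule ext)
      fix i assume i: "i \<in> I"
      then interpret left_module R "F i" by (rule F)
      show "(\<zero>\<^bsub>?D\<^esub> \<oplus>\<^bsub>?D\<^esub> u) i = u i"
        using i D(2)[OF u i] by (simp add: direct_sum_simps)
    qed (simp_all add: direct_sum_simps D(1)[OF u])
    define v where "v = (\<lambda>i\<in>I. \<ominus>\<^bsub>F i\<^esub> u i)"
    have "v \<in> carrier ?D"
    proof (rule direct_sum_memI[where S = "{i \<in> I. u i \<noteq> \<zero>\<^bsub>F i\<^esub>}"])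
      fix i assume i: "i \<in> I"
      then interpret left_module R "F i" by (rule F)
      show "v i \<in> carrier (F i)" using i D(2)[OF u i] by (simp add: v_def)
      show "v i = \<zero>\<^bsub>F i\<^esub>" if "i \<notin> {i \<in> I. u i \<noteq> \<zero>\<^bsub>F i\<^esub>}"
        using that i by (simp add: v_def)
    qed (use D(3)[OF u] in \<open>auto simp: v_def\<close>)
    moreover have "v \<oplus>\<^bsub>?D\<^esub> u = \<zero>\<^bsub>?D\<^esub>"
    proof (rule ext)
      fix i assume i: "i \<in> I"
      then interpret left_module R "F i" by (rule F)
      show "(v \<oplus>\<^bsub>?D\<^esub> u) i = \<zero>\<^bsub>?D\<^esub> i"
        using i D(2)[OF u i] by (simp add: direct_sum_simps v_def M.l_neg)
    qed (simp_all add: direct_sum_simps)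
    ultimately show "\<exists>v\<in>carrier ?D. v \<oplus>\<^bsub>?D\<^esub> u = \<zero>\<^bsub>?D\<^esub>" by blast
  qed (use add zero in auto)
  show ?thesis
  proof (intro left_module.intro left_module_axioms.intro)
    show "ring R" "abelian_group ?D" by fact+
    show "a \<odot>\<^bsub>?D\<^esub> u \<in> carrier ?D" if "a \<in> carrier R" "u \<in> carrier ?D" for a u
      using that by (rule smult)
  next
    fix a b u assume a: "a \<in> carrier R" "b \<in> carrier R" and u: "u \<in> carrier ?D"
    show "(a \<oplus>\<^bsub>R\<^esub> b) \<odot>\<^bsub>?D\<^esub> u = a \<odot>\<^bsub>?D\<^esub> u \<oplus>\<^bsub>?D\<^esub> b \<odot>\<^bsub>?D\<^esub> u"
      using D(2)[OF u] a left_module.smult_l_distr[OF F]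
      by (auto simp: direct_sum_simps restrict_def fun_eq_iff)
    show "(a \<otimes>\<^bsub>R\<^esub> b) \<odot>\<^bsub>?D\<^esub> u = a \<odot>\<^bsub>?D\<^esub> (b \<odot>\<^bsub>?D\<^esub> u)"
      using D(2)[OF u] a left_module.smult_assoc[OF F]
      by (auto simp: direct_sum_simps restrict_def fun_eq_iff)
  next
    fix a u v assume a: "a \<in> carrier R" and uv: "u \<in> carrier ?D" "v \<in> carrier ?D"
    show "a \<odot>\<^bsub>?D\<^esub> (u \<oplus>\<^bsub>?D\<^esub> v) = a \<odot>\<^bsub>?D\<^esub> u \<oplus>\<^bsub>?D\<^esub> a \<odot>\<^bsub>?D\<^esub> v"
      using D(2)[OF uv(1)] D(2)[OF uv(2)] a left_module.smult_r_distr[OF F]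
      by (auto simp: direct_sum_simps restrict_def fun_eq_iff)
  next
    fix u assume u: "u \<in> carrier ?D"
    show "\<one>\<^bsub>R\<^esub> \<odot>\<^bsub>?D\<^esub> u = u"
    proof (rule ext)
      fix i assume i: "i \<in> I"
      show "(\<one>\<^bsub>R\<^esub> \<odot>\<^bsub>?D\<^esub> u) i = u i"
        using i D(2)[OF u i] left_module.smult_one[OF F[OF i]] by (simp add: direct_sum_simps)
    qed (simp_all add: direct_sum_simps D(1)[OF u])
  qed
qed

section \<open>Coordinate embeddings and the universal property\<close>

definition ds_incl :: "'i set \<Rightarrow> ('i \<Rightarrow> ('r, 'x) module) \<Rightarrow> 'i \<Rightarrow> 'x \<Rightarrow> 'i \<Rightarrow> 'x" where
  "ds_incl I F i x = (\<lambda>j\<in>I. if j = i then x else \<zero>\<^bsub>F j\<^esub>)"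

lemma ds_incl_hom:
  assumes F: "\<And>i. i \<in> I \<Longrightarrow> left_module R (F i)" and i: "i \<in> I"
  shows "ds_incl I F i \<in> lm_hom R (F i) (direct_sum I F)"
proof (rule lm_homI)
  have zc: "\<zero>\<^bsub>F j\<^esub> \<in> carrier (F j)" "\<zero>\<^bsub>F j\<^esub> \<oplus>\<^bsub>F j\<^esub> \<zero>\<^bsub>F j\<^esub> = \<zero>\<^bsub>F j\<^esub>" if "j \<in> I" for j
  proof -
    interpret left_module R "F j" using F that .
    show "\<zero>\<^bsub>F j\<^esub> \<in> carrier (F j)" "\<zero>\<^bsub>F j\<^esub> \<oplus>\<^bsub>F j\<^esub> \<zero>\<^bsub>F j\<^esub> = \<zero>\<^bsub>F j\<^esub>" by simp_all
  qed
  show "ds_incl I F i x \<in> carrier (direct_sum I F)" if "x \<in> carrier (F i)" for x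
    by (rule direct_sum_memI[where S = "{i}"]) (use that zc in \<open>auto simp: ds_incl_def\<close>)
  show "ds_incl I F i (x \<oplus>\<^bsub>F i\<^esub> y) = ds_incl I F i x \<oplus>\<^bsub>direct_sum I F\<^esub> ds_incl I F i y" for x y
    using zc by (auto simp: direct_sum_simps ds_incl_def fun_eq_iff)
  show "ds_incl I F i (a \<odot>\<^bsub>F i\<^esub> x) = a \<odot>\<^bsub>direct_sum I F\<^esub> ds_incl I F i x"
    if "a \<in> carrier R" for a x
    using left_module.smult_zero_right[OF F that]
    by (auto simp: direct_sum_simps ds_incl_def fun_eq_iff)
qed

text \<open>By finite support, every element is reached from zero by adding values of coordinate
  embeddings one at a time. Claims about a map out of the sum thus reduce to the single
  summands.\<close>

lemma direct_sum_induct: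
  assumes F: "\<And>i. i \<in> I \<Longrightarrow> left_module R (F i)" and "u \<in> carrier (direct_sum I F)"
    and zero: "P \<zero>\<^bsub>direct_sum I F\<^esub>"
    and incl: "\<And>i x. i \<in> I \<Longrightarrow> x \<in> carrier (F i) \<Longrightarrow> P (ds_incl I F i x)"
    and add: "\<And>u v. u \<in> carrier (direct_sum I F) \<Longrightarrow> v \<in> carrier (direct_sum I F) \<Longrightarrow>
      P u \<Longrightarrow> P v \<Longrightarrow> P (u \<oplus>\<^bsub>direct_sum I F\<^esub> v)"
  shows "P u"
proof -
  let ?D = "direct_sum I F"
  \<comment> \<open>The induction runs over a finite set bounding the support, not over the support
    itself. Erasing coordinate \<open>i\<close> leaves an element bounded by the smaller set; if
    \<open>i\<close> is outside \<open>I\<close>, that set bounds \<open>u\<close> already.\<close>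
  have "P u" if "finite S" "u \<in> carrier ?D" "{i \<in> I. u i \<noteq> \<zero>\<^bsub>F i\<^esub>} \<subseteq> S" for S u
    using that
  proof (induction S arbitrary: u)
    case empty
    then have "u = \<zero>\<^bsub>?D\<^esub>"
      using direct_sum_memD(1)[OF empty(1)]
      by (intro extensionalityI[of _ I]) (auto simp: direct_sum_simps)
    then show ?case using zero by simp
  next
    case (insert i S)
    note D = direct_sum_memD[OF insert.prems(1)]
    show ?case
    proof (cases "i \<in> I")
      case False
      then show ?thesis using insert by blast
    next
      case i: True
      define v where "v = u(i := \<zero>\<^bsub>F i\<^esub>)"
      have z: "\<zero>\<^bsub>F j\<^esub> \<in> carrier (F j)" "\<And>x. x \<in> carrier (F j) \<Longrightarrow> \<zero>\<^bsub>F j\<^esub> \<oplus>\<^bsub>F j\<^esub> x = x"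
        "\<And>x. x \<in> carrier (F j) \<Longrightarrow> x \<oplus>\<^bsub>F j\<^esub> \<zero>\<^bsub>F j\<^esub> = x" if "j \<in> I" for j
      proof -
        interpret left_module R "F j" using F that .
        show "\<zero>\<^bsub>F j\<^esub> \<in> carrier (F j)" "\<And>x. x \<in> carrier (F j) \<Longrightarrow> \<zero>\<^bsub>F j\<^esub> \<oplus>\<^bsub>F j\<^esub> x = x"
          "\<And>x. x \<in> carrier (F j) \<Longrightarrow> x \<oplus>\<^bsub>F j\<^esub> \<zero>\<^bsub>F j\<^esub> = x" by simp_all
      qed
      have v: "v \<in> carrier ?D"
        by (rule direct_sum_memI[OF _ _ D(3)])
          (use D(1,2) z i in \<open>auto simp: v_def extensional_def\<close>)
      moreover have "{j \<in> I. v j \<noteq> \<zero>\<^bsub>F j\<^esub>} \<subseteq> S"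
        using insert.prems(2) by (auto simp: v_def)
      ultimately have "P v" using insert.IH by blast
      moreover have "u = v \<oplus>\<^bsub>?D\<^esub> ds_incl I F i (u i)"
        using D(1,2) z i
        by (intro extensionalityI[of _ I]) (auto simp: direct_sum_simps ds_incl_def v_def)
      ultimately show ?thesis
        using add[OF v lm_homD(1)[OF ds_incl_hom[where F = F, OF F i] D(2)[OF i]]] incl[OF i D(2)[OF i]]
        by simp
    qed
  qed
  then show ?thesis
    using assms(2) direct_sum_memD(3)[OF assms(2)] by blast
qed

text \<open>The map out of the direct sum given by its universal property. Summing over the support
  rather than over \<open>I\<close> is essential: \<open>finsum\<close> over an infinite set
  defaults to zero.\<close>

definition ds_copair ::
    "('r, 'm) module \<Rightarrow> 'i set \<Rightarrow> ('i \<Rightarrow> ('r, 'x) module) \<Rightarrow> ('i \<Rightarrow> 'x \<Rightarrow> 'm) \<Rightarrow> ('i \<Rightarrow> 'x) \<Rightarrow> 'm" where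
  "ds_copair M I F f u = (\<Oplus>\<^bsub>M\<^esub>i\<in>{i \<in> I. u i \<noteq> \<zero>\<^bsub>F i\<^esub>}. f i (u i))"

text \<open>Terms outside the support vanish because each \<open>f i\<close> preserves zero. The
  freedom in \<open>S\<close> allows elements with different supports to be summed over one index
  set.\<close>

lemma ds_copair_eq_finsum:
  assumes M: "left_module R M" and F: "\<And>i. i \<in> I \<Longrightarrow> left_module R (F i)"
    and f: "\<And>i. i \<in> I \<Longrightarrow> f i \<in> lm_hom R (F i) M"
    and u: "u \<in> carrier (direct_sum I F)"
    and S: "finite S" "S \<subseteq> I" "{i \<in> I. u i \<noteq> \<zero>\<^bsub>F i\<^esub>} \<subseteq> S"
  shows "ds_copair M I F f u = (\<Oplus>\<^bsub>M\<^esub>i\<in>S. f i (u i))"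
proof -
  interpret M: left_module R M by fact
  show ?thesis
    unfolding ds_copair_def
  proof (rule M.M.add.finprod_mono_neutral_cong_left[OF S(1,3)])
    fix i assume "i \<in> S - {i \<in> I. u i \<noteq> \<zero>\<^bsub>F i\<^esub>}"
    then have "i \<in> I" "u i = \<zero>\<^bsub>F i\<^esub>" using S(2) by auto
    then show "f i (u i) = \<zero>\<^bsub>M\<^esub>" using lm_hom_zero[OF F M f] by simp
  next
    show "(\<lambda>i. f i (u i)) \<in> S \<rightarrow> carrier M"
      using S(2) lm_homD(1)[OF f] direct_sum_memD(2)[OF u] by blast
  qed simp
qed

lemma ds_copair_hom:
  assumes R: "ring R" and M: "left_module R M" and F: "\<And>i. i \<in> I \<Longrightarrow> left_module R (F i)"
    and f: "\<And>i. i \<in> I \<Longrightarrow> f i \<in> lm_hom R (F i) M"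
  shows "ds_copair M I F f \<in> lm_hom R (direct_sum I F) M"
proof (rule lm_homI)
  let ?D = "direct_sum I F" and ?supp = "\<lambda>u. {i \<in> I. u i \<noteq> \<zero>\<^bsub>F i\<^esub>}"
  interpret M: left_module R M by fact
  interpret D: left_module R ?D by (rule left_module_direct_sum[OF R F])
  note mem = direct_sum_memD
  note eq = ds_copair_eq_finsum[where F = F and f = f, OF M F f]
  have c: "f i (u i) \<in> carrier M" if "u \<in> carrier ?D" "i \<in> I" for u i
    using that(2) by (intro lm_homD(1)[OF f] mem(2)[OF that(1)])
  show "ds_copair M I F f u \<in> carrier M" if "u \<in> carrier ?D" for u
    unfolding ds_copair_def using c[OF that] by (intro M.M.finsum_closed) auto
  show "ds_copair M I F f (u \<oplus>\<^bsub>?D\<^esub> v) = ds_copair M I F f u \<oplus>\<^bsub>M\<^esub> ds_copair M I F f v"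
    if u: "u \<in> carrier ?D" and v: "v \<in> carrier ?D" for u v
  proof -
    have uv: "u \<oplus>\<^bsub>?D\<^esub> v \<in> carrier ?D" using u v by simp
    \<comment> \<open>A common index set for all three sums, finite and containing the three
      supports by construction.\<close>
    define S where "S = ?supp u \<union> ?supp v \<union> ?supp (u \<oplus>\<^bsub>?D\<^esub> v)"
    have S: "finite S" "S \<subseteq> I" "?supp u \<subseteq> S" "?supp v \<subseteq> S" "?supp (u \<oplus>\<^bsub>?D\<^esub> v) \<subseteq> S"
      using mem(3)[OF u] mem(3)[OF v] mem(3)[OF uv] by (auto simp: S_def)
    have "ds_copair M I F f (u \<oplus>\<^bsub>?D\<^esub> v) = (\<Oplus>\<^bsub>M\<^esub>i\<in>S. f i ((u \<oplus>\<^bsub>?D\<^esub> v) i))"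
      using uv S by (intro eq) auto
    also have "\<dots> = (\<Oplus>\<^bsub>M\<^esub>i\<in>S. f i (u i) \<oplus>\<^bsub>M\<^esub> f i (v i))"
    proof (rule M.M.finsum_cong')
      fix i assume "i \<in> S"
      then have i: "i \<in> I" using S(2) by blast
      then show "f i ((u \<oplus>\<^bsub>?D\<^esub> v) i) = f i (u i) \<oplus>\<^bsub>M\<^esub> f i (v i)"
        using lm_homD(2)[OF f[OF i] mem(2)[OF u i] mem(2)[OF v i]] by (simp add: direct_sum_simps)
    qed (use S(2) c[OF u] c[OF v] in auto)
    also have "\<dots> = (\<Oplus>\<^bsub>M\<^esub>i\<in>S. f i (u i)) \<oplus>\<^bsub>M\<^esub> (\<Oplus>\<^bsub>M\<^esub>i\<in>S. f i (v i))"
      using S(2) c[OF u] c[OF v] by (intro M.M.finsum_addf) auto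
    also have "(\<Oplus>\<^bsub>M\<^esub>i\<in>S. f i (u i)) = ds_copair M I F f u"
      using u S by (intro eq[symmetric]) auto
    also have "(\<Oplus>\<^bsub>M\<^esub>i\<in>S. f i (v i)) = ds_copair M I F f v"
      using v S by (intro eq[symmetric]) auto
    finally show ?thesis .
  qed
  show "ds_copair M I F f (a \<odot>\<^bsub>?D\<^esub> u) = a \<odot>\<^bsub>M\<^esub> ds_copair M I F f u"
    if a: "a \<in> carrier R" and u: "u \<in> carrier ?D" for a u
  proof -
    have "?supp (a \<odot>\<^bsub>?D\<^esub> u) \<subseteq> ?supp u"
      using left_module.smult_zero_right[OF F a] by (auto simp: direct_sum_simps)
    then have "ds_copair M I F f (a \<odot>\<^bsub>?D\<^esub> u) = (\<Oplus>\<^bsub>M\<^esub>i\<in>?supp u. f i ((a \<odot>\<^bsub>?D\<^esub> u) i))"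
      using a u mem(3)[OF u] by (intro eq) auto
    also have "\<dots> = (\<Oplus>\<^bsub>M\<^esub>i\<in>?supp u. a \<odot>\<^bsub>M\<^esub> f i (u i))"
    proof (rule M.M.finsum_cong')
      fix i assume "i \<in> ?supp u"
      then have i: "i \<in> I" by blast
      then show "f i ((a \<odot>\<^bsub>?D\<^esub> u) i) = a \<odot>\<^bsub>M\<^esub> f i (u i)"
        using lm_homD(3)[OF f[OF i] a mem(2)[OF u i]] by (simp add: direct_sum_simps)
    qed (use a c[OF u] in auto)
    also have "\<dots> = a \<odot>\<^bsub>M\<^esub> ds_copair M I F f u"
      unfolding ds_copair_def using a c[OF u] by (intro M.smult_finsum[symmetric]) auto
    finally show ?thesis .
  qed
qed

text \<open>The sum is taken over \<open>{i}\<close>, which bounds the support even when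
  \<open>x\<close> is zero and the support is empty.\<close>

lemma ds_copair_incl:
  assumes M: "left_module R M" and F: "\<And>i. i \<in> I \<Longrightarrow> left_module R (F i)"
    and f: "\<And>i. i \<in> I \<Longrightarrow> f i \<in> lm_hom R (F i) M"
    and i: "i \<in> I" and x: "x \<in> carrier (F i)"
  shows "ds_copair M I F f (ds_incl I F i x) = f i x"
proof -
  interpret M: left_module R M by fact
  have "ds_copair M I F f (ds_incl I F i x) = (\<Oplus>\<^bsub>M\<^esub>j\<in>{i}. f j (ds_incl I F i x j))"
    using i lm_homD(1)[OF ds_incl_hom[where F = F, OF F i] x]
    by (intro ds_copair_eq_finsum[OF M F f]) (auto simp: ds_incl_def)
  also have "\<dots> = f i x"
    using i lm_homD(1)[OF f[OF i] x] by (simp add: ds_incl_def)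
  finally show ?thesis .
qed

section \<open>Finite generation of finitely presented modules\<close>

lemma left_module_regular_module:
  assumes "ring R"
  shows "left_module R (regular_module R)"
proof -
  interpret ring R by fact
  have "abelian_group (regular_module R)"
  proof (rule abelian_groupI)
    show "\<exists>y\<in>carrier (regular_module R). y \<oplus>\<^bsub>regular_module R\<^esub> x = \<zero>\<^bsub>regular_module R\<^esub>"
      if "x \<in> carrier (regular_module R)" for x
      using that l_neg by (auto simp: regular_module_def intro!: bexI[of _ "\<ominus>\<^bsub>R\<^esub> x"])
  qed (simp_all add: regular_module_def a_ac)
  then show ?thesis
    using assms
    by (intro left_module.intro left_module_axioms.intro)
      (simp_all add: regular_module_def l_distr r_distr m_assoc)
qed

text \<open>The generators are the images of the standard basis vectors of the free module that maps
  onto \<open>X\<close>. Generation is expressed through submodules containing \<open>A\<close>, the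
  form applied to preimages of filtration steps.\<close>

lemma finitely_presented_imp_finitely_generated:
  assumes R: "ring R" and X: "left_module R X" and "finitely_presented R X"
  obtains A where "finite A" "A \<subseteq> carrier X" "\<And>H. submodule H R X \<Longrightarrow> A \<subseteq> H \<Longrightarrow> carrier X \<subseteq> H"
proof -
  interpret R: ring R by fact
  interpret X: left_module R X by fact
  obtain n g where g: "g \<in> lm_hom R (free_module R n) X"
      and surj: "g ` carrier (free_module R n) = carrier X"
    using assms(3) by (auto simp: finitely_presented_def)
  let ?F = "\<lambda>_ :: nat. regular_module R" and ?I = "{..<n}"
  let ?D = "direct_sum ?I ?F"
  have F: "left_module R (?F i)" for i by (rule left_module_regular_module[OF R])
  interpret D: left_module R ?D by (rule left_module_direct_sum[OF R F])
  have g: "g \<in> lm_hom R ?D X" using g by (simp add: free_module_def)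
  define e where "e i = ds_incl ?I ?F i \<one>\<^bsub>R\<^esub>" for i
  have cF: "carrier (?F i) = carrier R" for i by (simp add: regular_module_def)
  have e: "e i \<in> carrier ?D" if "i \<in> ?I" for i
    using lm_homD(1)[OF ds_incl_hom[where F = ?F, OF F that], of "\<one>\<^bsub>R\<^esub>"] by (simp add: e_def cF)
  show thesis
  proof
    show "finite (g ` e ` ?I)" by simp
    show "g ` e ` ?I \<subseteq> carrier X" using e lm_homD(1)[OF g] by auto
  next
    fix H assume H: "submodule H R X" and sub: "g ` e ` ?I \<subseteq> H"
    note HX = X.submoduleD[OF H]
    have "g u \<in> H" if "u \<in> carrier ?D" for u
      using F that
    proof (rule direct_sum_induct[where F = ?F])
      show "g \<zero>\<^bsub>?D\<^esub> \<in> H" using lm_hom_zero[OF D.left_module_axioms X g] HX(2) by simp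
      show "g (u \<oplus>\<^bsub>?D\<^esub> v) \<in> H"
        if "u \<in> carrier ?D" "v \<in> carrier ?D" "g u \<in> H" "g v \<in> H" for u v
        using that HX(4) lm_homD(2)[OF g] by simp
      show "g (ds_incl ?I ?F i x) \<in> H" if i: "i \<in> ?I" and x: "x \<in> carrier (?F i)" for i x
      proof -
        \<comment> \<open>Writing \<open>x\<close> as \<open>x\<close> times one exhibits the
          embedded element as a scalar multiple of the basis vector \<open>e i\<close>.\<close>
        have "ds_incl ?I ?F i x = ds_incl ?I ?F i (x \<odot>\<^bsub>?F i\<^esub> \<one>\<^bsub>R\<^esub>)"
          using x by (simp add: regular_module_def)
        also have "\<dots> = x \<odot>\<^bsub>?D\<^esub> e i"
          using x lm_homD(3)[OF ds_incl_hom[where F = ?F, OF F i]] by (simp add: e_def cF)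
        finally have "g (ds_incl ?I ?F i x) = x \<odot>\<^bsub>X\<^esub> g (e i)"
          using x lm_homD(3)[OF g] e[OF i] by (simp add: cF)
        moreover have "g (e i) \<in> H" using sub i by blast
        ultimately show ?thesis using HX(5) x by (simp add: cF)
      qed
    qed
    then show "carrier X \<subseteq> H" using surj by (auto simp: free_module_def simp flip: surj)
  qed
qed

text \<open>Each coordinate embedding followed by the inverse isomorphism is a map from a member of
  \<open>\<X>\<close> to \<open>M\<close>, so its image lies in the trace; these images together
  generate \<open>M\<close>.\<close>

lemma X_trace_eq_carrier_of_direct_sum:
  assumes R: "ring R" and S: "semibrick R \<X>" and M: "left_module R M"
    and F: "F \<in> I \<rightarrow> \<X>" and iso: "lm_isomorphic R M (direct_sum I F)"
  shows "X_trace R \<X> M = carrier M"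
proof
  interpret M: left_module R M by fact
  have LF: "left_module R (F i)" if "i \<in> I" for i
    using semibrick_left_module[OF S] F that by blast
  let ?D = "direct_sum I F"
  interpret D: left_module R ?D by (rule left_module_direct_sum[OF R LF])
  obtain h where h: "h \<in> lm_hom R M ?D" "bij_betw h (carrier M) (carrier ?D)"
    using iso by (auto simp: lm_isomorphic_def)
  define g where "g = inv_into (carrier M) h"
  have g: "g \<in> lm_hom R ?D M" unfolding g_def by (rule lm_hom_inv_into[OF M h])
  have surj: "g ` carrier ?D = carrier M"
    using bij_betw_inv_into[OF h(2)] by (simp add: g_def bij_betw_def)
  show "X_trace R \<X> M \<subseteq> carrier M"
    unfolding X_trace_def sum_submodules_def
    using M.submodule_carrier by (intro Inter_lower) (auto simp: lm_hom_def)
  show "carrier M \<subseteq> X_trace R \<X> M"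
    unfolding X_trace_def sum_submodules_def
  proof (intro Inter_greatest, clarify)
    \<comment> \<open>The trace is an intersection, so an arbitrary submodule \<open>H\<close>
      containing all the images has to exhaust \<open>M\<close>.\<close>
    fix H m assume H: "submodule H R M"
      and sub: "\<Union>{f ` carrier X |X f. X \<in> \<X> \<and> f \<in> lm_hom R X M} \<subseteq> H" and m: "m \<in> carrier M"
    note HM = M.submoduleD[OF H]
    have "g u \<in> H" if "u \<in> carrier ?D" for u
      using LF that
    proof (rule direct_sum_induct[where F = F])
      show "g \<zero>\<^bsub>?D\<^esub> \<in> H" using lm_hom_zero[OF D.left_module_axioms M g] HM(2) by simp
      show "g (u \<oplus>\<^bsub>?D\<^esub> v) \<in> H"
        if "u \<in> carrier ?D" "v \<in> carrier ?D" "g u \<in> H" "g v \<in> H" for u v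
        using that HM(4) lm_homD(2)[OF g] by simp
      show "g (ds_incl I F i x) \<in> H" if i: "i \<in> I" and x: "x \<in> carrier (F i)" for i x
      proof -
        have "(\<lambda>x. g (ds_incl I F i x)) \<in> lm_hom R (F i) M"
          using ds_incl_hom[where F = F, OF LF i] g by (rule lm_hom_comp)
        moreover have "F i \<in> \<X>" using F i by blast
        ultimately show ?thesis using sub x by blast
      qed
    qed
    then have "g ` carrier ?D \<subseteq> H" by (rule image_subsetI)
    with m show "m \<in> H" unfolding surj by (rule rev_subsetD)
  qed
qed

section \<open>Filtrations by bricks\<close>

text \<open>Serves twice: to pick the top index in the support of an element of the direct sum, and
  to find one filtration step that receives finitely many generators.\<close>

lemma Well_order_finite_greatest:
  assumes "Well_order r" and "finite A" "A \<noteq> {}" "A \<subseteq> Field r"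
  obtains m where "m \<in> A" "\<And>a. a \<in> A \<Longrightarrow> (a, m) \<in> r"
proof -
  interpret W: wo_rel r using assms(1) by (simp add: wo_rel_def)
  have "\<exists>m\<in>A. \<forall>a\<in>A. (a, m) \<in> r"
    using assms(2-4)
  proof (induction rule: finite_ne_induct)
    case (singleton x)
    then show ?case using W.REFL by (auto simp: refl_on_def)
  next
    case (insert x A)
    then obtain m where m: "m \<in> A" "\<forall>a\<in>A. (a, m) \<in> r" by auto
    have xm: "x \<in> Field r" "m \<in> Field r" using insert.prems m by auto
    then have "(x, m) \<in> r \<or> (m, x) \<in> r" using W.TOTALS by auto
    then show ?case
    proof
      assume "(x, m) \<in> r"
      then show ?thesis using m by auto
    next
      assume "(m, x) \<in> r"
      then have "\<forall>a\<in>A. (a, x) \<in> r" using m W.TRANS by (meson transD)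
      then show ?thesis using xm W.REFL by (auto simp: refl_on_def)
    qed
  qed
  then show thesis using that by blast
qed

text \<open>The lower end of a successor step determines the upper one, so lower ends alone can
  index the chosen maps.\<close>

lemma is_succ_unique:
  assumes "Well_order r" "is_succ r i j" "is_succ r i k"
  shows "j = k"
proof -
  interpret W: wo_rel r using assms(1) by (simp add: wo_rel_def)
  have "(j, k) \<in> r" "(k, j) \<in> r" using assms(2,3) by (auto simp: is_succ_def)
  then show ?thesis using W.ANTISYM by (auto dest: antisymD)
qed

text \<open>The summands are indexed by lower ends of successor steps of the filtration, which is
  why the index set has the type of the well-order \<open>r\<close>.\<close>

lemma X_filtration_trace_imp_direct_sum:
  fixes r :: "'i rel" and \<X> :: "('r, 'x) module set" and M :: "('r, 'm) module"
  assumes R: "ring R" and S: "semibrick R \<X>" and M: "left_module R M"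
    and filt: "X_filtration R \<X> M r \<mu> C" and trace: "X_trace R \<X> M = carrier M"
  shows "\<exists>(I :: 'i set) F. F \<in> I \<rightarrow> \<X> \<and> lm_isomorphic R M (direct_sum I F)"
proof -
  interpret M: left_module R M by fact
  have wo: "Well_order r" and mu: "\<mu> \<in> Field r"
    and sub: "\<And>i. i \<in> Field r \<Longrightarrow> submodule (C i) R M"
    and mono: "\<And>i j. (i, j) \<in> r \<Longrightarrow> C i \<subseteq> C j"
    and zero: "\<And>i. i \<in> Field r \<Longrightarrow> underS r i = {} \<Longrightarrow> C i = {\<zero>\<^bsub>M\<^esub>}"
    and C_top: "C \<mu> = carrier M"
    and lim: "\<And>i. is_limit r i \<Longrightarrow> C i = (\<Union>j\<in>underS r i. C j)"
    and factor: "\<And>i j. is_succ r i j \<Longrightarrow> \<exists>X\<in>\<X>. lm_isomorphic R (quot_module M (C j) (C i)) X"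
    using filt by (auto simp: X_filtration_def filtration_def)
  interpret W: wo_rel r using wo by (simp add: wo_rel_def)
  note LX = semibrick_left_module[OF S]
  have fld: "i \<in> Field r" "j \<in> Field r" if "is_succ r i j" for i j
    using that by (auto simp: is_succ_def Field_def)
  \<comment> \<open>The level of a map: its image stays inside \<open>C j\<close> but is nonzero
    modulo \<open>C i\<close>, so it induces a nonzero map from \<open>X\<close> to the factor
    between them.\<close>
  define E where "E i j X f \<longleftrightarrow> is_succ r i j \<and> X \<in> \<X> \<and> f \<in> lm_hom R X M \<and>
    f ` carrier X \<subseteq> C j \<and> \<not> f ` carrier X \<subseteq> C i" for i j X f
  have E: "is_succ r i j" "X \<in> \<X>" "f \<in> lm_hom R X M" "\<And>x. x \<in> carrier X \<Longrightarrow> f x \<in> C j"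
      "\<exists>x\<in>carrier X. f x \<notin> C i" if "E i j X f" for i j X f
    using that by (auto simp: E_def)
  have proj: "\<exists>p Y. Y \<in> \<X> \<and> p \<in> lm_hom R (M\<lparr>carrier := C j\<rparr>) Y \<and>
      (\<forall>x\<in>C j. p x = \<zero>\<^bsub>Y\<^esub> \<longleftrightarrow> x \<in> C i)" if s: "is_succ r i j" for i j
  proof -
    obtain Y where Y: "Y \<in> \<X>" "lm_isomorphic R (quot_module M (C j) (C i)) Y"
      using factor[OF s] by blast
    obtain p where "p \<in> lm_hom R (M\<lparr>carrier := C j\<rparr>) Y" "\<And>x. x \<in> C j \<Longrightarrow> p x = \<zero>\<^bsub>Y\<^esub> \<longleftrightarrow> x \<in> C i"
      using quot_module_iso_lift[OF M LX[OF Y(1)] sub[OF fld(2)[OF s]] sub[OF fld(1)[OF s]] Y(2)]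
      by blast
    with Y(1) show ?thesis by blast
  qed
  have comp: "(\<lambda>x. p (f x)) \<in> lm_hom R X Y"
    if "f \<in> lm_hom R X M" "\<And>x. x \<in> carrier X \<Longrightarrow> f x \<in> C j"
      "p \<in> lm_hom R (M\<lparr>carrier := C j\<rparr>) Y" for f p j X Y
    using that by (auto simp: lm_hom_def Pi_iff)
  \<comment> \<open>A map into \<open>C j\<close> that does not land in \<open>C i\<close> is a section, up to an automorphism of the brick,
    of the projection \<open>C j \<rightarrow> C j / C i\<close>.\<close>
  have split: "Y = X \<and> (\<exists>g\<in>lm_hom R X X. \<forall>x\<in>carrier X. g (p (f x)) = x \<and> p (f (g x)) = x)"
    if e: "E i j X f" and Y: "Y \<in> \<X>" and p: "p \<in> lm_hom R (M\<lparr>carrier := C j\<rparr>) Y"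
      and ker: "\<forall>x\<in>C j. p x = \<zero>\<^bsub>Y\<^esub> \<longleftrightarrow> x \<in> C i" for i j X f p Y
  proof -
    obtain x where x: "x \<in> carrier X" "f x \<notin> C i" using E(5)[OF e] by blast
    have nz: "p (f x) \<noteq> \<zero>\<^bsub>Y\<^esub>" using ker x E(4)[OF e] by blast
    obtain g where "Y = X" "g \<in> lm_hom R X X"
      "\<And>x. x \<in> carrier X \<Longrightarrow> g (p (f x)) = x" "\<And>x. x \<in> carrier X \<Longrightarrow> p (f (g x)) = x"
      using semibrick_nonzero_hom_iso[OF S E(2)[OF e] Y comp[OF E(3)[OF e] E(4)[OF e] p] x(1) nz]
      by metis
    then show ?thesis by blast
  qed
  define I where "I = {i. \<exists>j X f. E i j X f}"
  have "\<forall>i\<in>I. \<exists>j X f. E i j X f" by (simp add: I_def)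
  \<comment> \<open>Choice fixes one step, one brick and one map for each level in
    \<open>I\<close>.\<close>
  then obtain s F \<phi> where EI: "\<And>i. i \<in> I \<Longrightarrow> E i (s i) (F i) (\<phi> i)" by metis
  have IF: "I \<subseteq> Field r" using EI E(1) fld(1) by blast
  have FX: "F i \<in> \<X>" if "i \<in> I" for i using E(2)[OF EI[OF that]] .
  have LF: "left_module R (F i)" if "i \<in> I" for i using LX[OF FX[OF that]] .
  have phi: "\<phi> i \<in> lm_hom R (F i) M" if "i \<in> I" for i using E(3)[OF EI[OF that]] .
  let ?D = "direct_sum I F"
  define \<Phi> where "\<Phi> = ds_copair M I F \<phi>"
  have LD: "left_module R ?D" by (rule left_module_direct_sum[OF R LF])
  then interpret D: left_module R ?D .
  have Phi: "\<Phi> \<in> lm_hom R ?D M"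
    unfolding \<Phi>_def by (rule ds_copair_hom[OF R M LF phi])

  \<comment> \<open>Directness of the sum: a nonzero \<open>u\<close> in the kernel of
    \<open>\<Phi>\<close> is refuted at the greatest index \<open>m\<close> of its support.\<close>
  have ker: "u = \<zero>\<^bsub>?D\<^esub>" if u: "u \<in> carrier ?D" and u0: "\<Phi> u = \<zero>\<^bsub>M\<^esub>" for u
  proof (rule ccontr)
    assume "u \<noteq> \<zero>\<^bsub>?D\<^esub>"
    note mem = direct_sum_memD[OF u]
    define A where "A = {i \<in> I. u i \<noteq> \<zero>\<^bsub>F i\<^esub>}"
    have A: "finite A" "A \<subseteq> I" "A \<noteq> {}"
    proof -
      show "finite A" "A \<subseteq> I" using mem(3) by (auto simp: A_def)
      show "A \<noteq> {}"
      proof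
        assume "A = {}"
        then have "u = \<zero>\<^bsub>?D\<^esub>"
          using mem(1) by (intro extensionalityI[of _ I]) (auto simp: direct_sum_simps A_def)
        with \<open>u \<noteq> \<zero>\<^bsub>?D\<^esub>\<close> show False by simp
      qed
    qed
    obtain m where m: "m \<in> A" "\<And>a. a \<in> A \<Longrightarrow> (a, m) \<in> r"
      using Well_order_finite_greatest[OF wo A(1,3)] A(2) IF by blast
    have mI: "m \<in> I" using m A by blast
    have c: "\<phi> i (u i) \<in> carrier M" if "i \<in> A" for i
      using that A(2) lm_homD(1)[OF phi mem(2)] by blast
    note Cm = M.submoduleD[OF sub]
    have mF: "m \<in> Field r" using IF mI by blast
    \<comment> \<open>For \<open>i\<close> strictly below \<open>m\<close>, the successor
      \<open>s i\<close> is at most \<open>m\<close>, so the term of index \<open>i\<close> already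
      lies in \<open>C m\<close>.\<close>
    have rest: "(\<Oplus>\<^bsub>M\<^esub>i\<in>A - {m}. \<phi> i (u i)) \<in> C m"
    proof (rule M.submodule_finsum[OF sub[OF mF]])
      fix i assume i: "i \<in> A - {m}"
      then have iI: "i \<in> I" using A by blast
      have "(s i, m) \<in> r" using E(1)[OF EI[OF iI]] m(2)[of i] i by (auto simp: is_succ_def)
      moreover have "\<phi> i (u i) \<in> C (s i)" using E(4)[OF EI[OF iI] mem(2)[OF iI]] .
      ultimately show "\<phi> i (u i) \<in> C m" using mono by blast
    qed
    have "\<phi> m (u m) \<oplus>\<^bsub>M\<^esub> (\<Oplus>\<^bsub>M\<^esub>i\<in>A - {m}. \<phi> i (u i)) = (\<Oplus>\<^bsub>M\<^esub>i\<in>insert m (A - {m}). \<phi> i (u i))"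
      using A(1) c m(1) by (intro M.M.finsum_insert[symmetric]) auto
    also have "insert m (A - {m}) = A" using m(1) by blast
    also have "(\<Oplus>\<^bsub>M\<^esub>i\<in>A. \<phi> i (u i)) = \<zero>\<^bsub>M\<^esub>"
      using u0 by (simp add: \<Phi>_def ds_copair_def A_def)
    finally have "\<ominus>\<^bsub>M\<^esub> (\<Oplus>\<^bsub>M\<^esub>i\<in>A - {m}. \<phi> i (u i)) = \<phi> m (u m)"
      using c[OF m(1)] rest Cm(1)[OF mF] by (intro M.M.minus_equality) auto
    \<comment> \<open>The top term is minus the sum of the others, hence lies in \<open>C m\<close>
      and is killed by \<open>p\<close>. As \<open>g\<close> undoes \<open>p\<close> after
      \<open>\<phi> m\<close>, the coordinate \<open>u m\<close> is zero, contrary to the choice of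
      \<open>m\<close>.\<close>
    then have in_Cm: "\<phi> m (u m) \<in> C m" using Cm(3)[OF mF rest] by simp
    obtain p Y where p: "Y \<in> \<X>" "p \<in> lm_hom R (M\<lparr>carrier := C (s m)\<rparr>) Y"
        "\<forall>x\<in>C (s m). p x = \<zero>\<^bsub>Y\<^esub> \<longleftrightarrow> x \<in> C m"
      using proj[OF E(1)[OF EI[OF mI]]] by blast
    obtain g where Y: "Y = F m" and g: "g \<in> lm_hom R (F m) (F m)"
        "\<forall>x\<in>carrier (F m). g (p (\<phi> m x)) = x \<and> p (\<phi> m (g x)) = x"
      using split[OF EI[OF mI] p] by blast
    have "p (\<phi> m (u m)) = \<zero>\<^bsub>F m\<^esub>"
      using in_Cm p(3) E(4)[OF EI[OF mI] mem(2)[OF mI]] Y by blast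
    then have "u m = g \<zero>\<^bsub>F m\<^esub>" using g(2) mem(2)[OF mI] by metis
    also have "\<dots> = \<zero>\<^bsub>F m\<^esub>" using lm_hom_zero[OF LF[OF mI] LF[OF mI] g(1)] .
    finally show False using m(1) by (simp add: A_def)
  qed

  define T where "T = \<Phi> ` carrier ?D"
  have T: "submodule T R M" unfolding T_def by (rule submodule_image[OF LD M Phi])
  note TM = M.submoduleD[OF T]
  have phi_T: "\<phi> i x \<in> T" if "i \<in> I" "x \<in> carrier (F i)" for i x
  proof -
    have "\<phi> i x = \<Phi> (ds_incl I F i x)"
      unfolding \<Phi>_def using ds_copair_incl[where F = F and f = \<phi>, OF M LF phi that] by simp
    then show ?thesis
      unfolding T_def using lm_homD(1)[OF ds_incl_hom[where F = F, OF LF that(1)] that(2)] by blast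
  qed
  \<comment> \<open>Every \<open>X\<close> and \<open>f\<close> is quantified inside the claim
    because the successor case applies it to a new map. The field condition is a premise since the
    well-order induction ranges over the whole type.\<close>
  have *: "i \<in> Field r \<longrightarrow> (\<forall>X\<in>\<X>. \<forall>f\<in>lm_hom R X M. f ` carrier X \<subseteq> C i \<longrightarrow> f ` carrier X \<subseteq> T)" for i
  proof (induction i rule: W.well_order_induct)
    case (1 i)
    have IH: "f ` carrier X \<subseteq> T"
      if "(j, i) \<in> r" "j \<noteq> i" "X \<in> \<X>" "f \<in> lm_hom R X M" "f ` carrier X \<subseteq> C j" for j X f
    proof -
      have "j \<in> Field r" using that(1) by (auto simp: Field_def)
      then show ?thesis using 1 that by blast
    qed
    show ?case
    proof (intro impI ballI)
      fix X f assume i: "i \<in> Field r" and X: "X \<in> \<X>" and f: "f \<in> lm_hom R X M"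
        and im: "f ` carrier X \<subseteq> C i"
      consider "underS r i = {}" | "is_limit r i" | j where "is_succ r j i"
        using i by (auto simp: is_limit_def)
      then show "f ` carrier X \<subseteq> T"
      proof cases
        case 1
        have "C i \<subseteq> T" using zero[OF i 1] TM(2) by simp
        with im show ?thesis by (rule subset_trans)
      next
        case 2
        obtain A where A: "finite A" "A \<subseteq> carrier X"
          "\<And>H. submodule H R X \<Longrightarrow> A \<subseteq> H \<Longrightarrow> carrier X \<subseteq> H"
          using finitely_presented_imp_finitely_generated[OF R LX[OF X]] S X
          by (auto simp: semibrick_def brick_def)
        \<comment> \<open>At a limit, each of the finitely many generators lands in an earlier step.
          The largest of these steps receives all generators, hence all of \<open>X\<close>, and the
          induction hypothesis applies.\<close>
        have "\<forall>a\<in>A. \<exists>j\<in>underS r i. f a \<in> C j" using A(2) im lim[OF 2] by blast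
        then obtain k where k: "\<And>a. a \<in> A \<Longrightarrow> k a \<in> underS r i \<and> f a \<in> C (k a)" by metis
        \<comment> \<open>The extra index \<open>j0\<close> provides a step below \<open>i\<close>
          even when the generating set \<open>A\<close> is empty.\<close>
        obtain j0 where j0: "j0 \<in> underS r i" using 2 by (auto simp: is_limit_def)
        have uF: "underS r i \<subseteq> Field r" by (auto simp: underS_def Field_def)
        have "insert j0 (k ` A) \<subseteq> Field r" using k j0 uF by blast
        then obtain j where j: "j \<in> insert j0 (k ` A)"
            "\<And>l. l \<in> insert j0 (k ` A) \<Longrightarrow> (l, j) \<in> r"
          using Well_order_finite_greatest[OF wo, of "insert j0 (k ` A)"] A(1) by blast
        have jS: "j \<in> underS r i" using j(1) k j0 by blast
        have "submodule {x \<in> carrier X. f x \<in> C j} R X"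
          using submodule_vimage[OF LX[OF X] M f sub] jS uF by blast
        moreover have "A \<subseteq> {x \<in> carrier X. f x \<in> C j}"
          using A(2) k j(2) mono by blast
        ultimately have "f ` carrier X \<subseteq> C j" using A(3) by blast
        then show ?thesis using IH[OF _ _ X f] jS by (auto simp: underS_def)
      next
        case (3 j)
        have ji: "(j, i) \<in> r" "j \<noteq> i" using 3 by (auto simp: is_succ_def)
        show ?thesis
        proof (cases "f ` carrier X \<subseteq> C j")
          case True
          then show ?thesis using IH ji X f by blast
        next
          case False
          then have e: "E j i X f" using 3 X f im by (simp add: E_def)
          then have jI: "j \<in> I" by (auto simp: I_def)
          \<comment> \<open>The chosen map at \<open>j\<close> ends in the same step as
            \<open>f\<close>, so a single projection \<open>p\<close> can be compared with both;
            this identifies \<open>X\<close> with \<open>F j\<close>.\<close>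
          have "s j = i" using is_succ_unique[OF wo E(1)[OF EI[OF jI]] 3] .
          then have ej: "E j i (F j) (\<phi> j)" using EI[OF jI] by simp
          obtain p Y where p: "Y \<in> \<X>" "p \<in> lm_hom R (M\<lparr>carrier := C i\<rparr>) Y"
            "\<forall>x\<in>C i. p x = \<zero>\<^bsub>Y\<^esub> \<longleftrightarrow> x \<in> C j"
            using proj[OF 3] by blast
          have YX: "Y = X" using split[OF e p] by blast
          obtain g where YF: "Y = F j" and g: "g \<in> lm_hom R (F j) (F j)"
            "\<forall>x\<in>carrier (F j). g (p (\<phi> j x)) = x \<and> p (\<phi> j (g x)) = x"
            using split[OF ej p] by blast
          have FX: "F j = X" using YX YF by simp
          note gX = g[unfolded FX] and pX = p[unfolded YX] and phX = phi[OF jI, unfolded FX]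
          have pf: "(\<lambda>x. p (f x)) \<in> lm_hom R X X" using comp[OF f E(4)[OF e] pX(2)] .
          \<comment> \<open>Since \<open>g\<close> inverts \<open>p\<close> after
            \<open>\<phi> j\<close>, the map \<open>q\<close> agrees with \<open>f\<close> modulo
            \<open>C j\<close> while taking values in \<open>T\<close>.\<close>
          define q where "q x = \<phi> j (g (p (f x)))" for x
          have q: "q \<in> lm_hom R X M"
            unfolding q_def using lm_hom_comp[OF lm_hom_comp[OF pf gX(1)] phX] .
          have gp: "g (p (f x)) \<in> carrier X" if "x \<in> carrier X" for x
            using lm_homD(1)[OF lm_hom_comp[OF pf gX(1)] that] .
          have qT: "q x \<in> T" if "x \<in> carrier X" for x
            unfolding q_def using phi_T[OF jI] gp[OF that] FX by simp
          have qC: "q x \<in> C i" if "x \<in> carrier X" for x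
            unfolding q_def using E(4)[OF ej] gp[OF that] FX by simp
          have pq: "p (q x) = p (f x)" if "x \<in> carrier X" for x
            unfolding q_def using gX(2) lm_homD(1)[OF pf that] by simp
          define d where "d x = f x \<ominus>\<^bsub>M\<^esub> q x" for x
          have d: "d \<in> lm_hom R X M" unfolding d_def by (rule lm_hom_diff[OF M f q])
          note Ci = M.submoduleD[OF sub[OF i]]
          have fq: "f x \<in> C i" "f x \<in> carrier M" "q x \<in> carrier M" if "x \<in> carrier X" for x
            using E(4)[OF e that] qC[OF that] Ci(1) by auto
          have dC: "d x \<in> C i" if "x \<in> carrier X" for x
            unfolding d_def a_minus_def using fq(1)[OF that] qC[OF that] Ci(3,4) by blast
          have df: "d x \<oplus>\<^bsub>M\<^esub> q x = f x" if "x \<in> carrier X" for x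
            using fq[OF that] by (simp add: d_def a_minus_def M.M.a_assoc M.M.l_neg)
          interpret X: left_module R X by (rule LX[OF X])
          \<comment> \<open>Applying \<open>p\<close> to \<open>f x\<close> as the sum of
            \<open>d x\<close> and \<open>q x\<close>, where \<open>p (q x) = p (f x)\<close>,
            forces \<open>p (d x)\<close> to vanish. So \<open>d\<close> lands in the lower step
            \<open>C j\<close>, and the induction hypothesis puts it into \<open>T\<close>.\<close>
          have "d x \<in> C j" if x: "x \<in> carrier X" for x
          proof -
            have "p (f x) = p (d x) \<oplus>\<^bsub>X\<^esub> p (f x)"
              using lm_homD(2)[OF pX(2), of "d x" "q x"] dC[OF x] qC[OF x] df[OF x] pq[OF x] by simp
            moreover have "p (d x) \<in> carrier X" using lm_homD(1)[OF pX(2)] dC[OF x] by simp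
            ultimately have "p (d x) = \<zero>\<^bsub>X\<^esub>"
              using lm_homD(1)[OF pf x] by simp
            then show ?thesis using pX(3) dC[OF x] by blast
          qed
          then have "d ` carrier X \<subseteq> T" using IH[OF ji X d] by blast
          then have "f x \<in> T" if "x \<in> carrier X" for x
            using TM(4)[of "d x" "q x"] qT[OF that] df[OF that] that by auto
          then show ?thesis by blast
        qed
      qed
    qed
  qed
  have all_T: "f ` carrier X \<subseteq> T" if X: "X \<in> \<X>" and f: "f \<in> lm_hom R X M" for X f
  proof -
    have "f ` carrier X \<subseteq> C \<mu>" unfolding C_top using lm_homD(1)[OF f] by blast
    then show ?thesis using * mu X f by blast
  qed
  \<comment> \<open>\<open>T\<close> is one of the submodules whose intersection is the trace;
    together with the assumption on the trace this makes \<open>\<Phi>\<close> surjective.\<close>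
  have "X_trace R \<X> M \<subseteq> T"
    unfolding X_trace_def sum_submodules_def
  proof (rule Inter_lower, rule CollectI, rule conjI[OF T], rule Union_least)
    fix Z assume "Z \<in> {f ` carrier X |X f. X \<in> \<X> \<and> f \<in> lm_hom R X M}"
    then obtain X f where "Z = f ` carrier X" "X \<in> \<X>" "f \<in> lm_hom R X M" by blast
    then show "Z \<subseteq> T" using all_T by simp
  qed
  then have "\<Phi> ` carrier ?D = carrier M" using trace TM(1) by (simp add: T_def)
  moreover have "inj_on \<Phi> (carrier ?D)" using ker by (rule lm_hom_inj_onI[OF LD M Phi])
  ultimately have bij: "bij_betw \<Phi> (carrier ?D) (carrier M)" by (simp add: bij_betw_def)
  have "lm_isomorphic R M ?D"
    unfolding lm_isomorphic_def
    using lm_hom_inv_into[OF LD Phi bij] bij_betw_inv_into[OF bij] by blast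
  then show ?thesis using FX by blast
qed

theorem proposition3p2:
  fixes R :: "('r, 's) ring_scheme"
    and \<X> :: "('r, 'x) module set"
    and M :: "('r, 'm) module"
  assumes "ring R"
    and "semibrick R \<X>"
    and "M \<in> Filt R \<X>"
  shows "X_semisimple R \<X> M \<longleftrightarrow> X_trace R \<X> M = carrier M"
proof
  have M: "left_module R M" using assms(3) by (simp add: Filt_def)
  assume "X_semisimple R \<X> M"
  then obtain I :: "'m set" and F where "F \<in> I \<rightarrow> \<X>" "lm_isomorphic R M (direct_sum I F)"
    unfolding X_semisimple_def by blast
  then show "X_trace R \<X> M = carrier M"
    by (rule X_trace_eq_carrier_of_direct_sum[OF assms(1,2) M])
next
  assume trace: "X_trace R \<X> M = carrier M"
  \<comment> \<open>The well-order lives on the elements of \<open>M\<close>, so the summands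
    obtained from it have indices of the type that \<open>X_semisimple\<close> requires.\<close>
  obtain r :: "'m rel" and \<mu> C where M: "left_module R M" and C: "X_filtration R \<X> M r \<mu> C"
    using assms(3) by (auto simp: Filt_def)
  then show "X_semisimple R \<X> M"
    unfolding X_semisimple_def
    using X_filtration_trace_imp_direct_sum[OF assms(1,2) M C trace] assms(3) by blast
qed

end
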